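(* Let $n\ge 2$, let $B_n$ be the Artin braid group on $n$ strings with standard generators $\sigma_1,\dots,\sigma_{n-1}$, and let $P_n\subset B_n$ be the pure braid group. (a) $\operatorname{G}(B_n)=1$ if $n=2$ and $\operatorname{G}(B_n)=2$ if $n\ge 3$. Furthermore, for all $n\ge 2$, the normal closure of $\sigma_1$ in $B_n$ is $B_n$, so $\operatorname{NG}(B_n)=1$. (b) $\operatorname{NG}(P_n)=\operatorname{G}(P_n)=\operatorname{G}(P_n^{\mathrm{Ab}})=n(n-1)/2$.
   Context: The Artin braid group $B_n$ (the braid group of the $2$-disc) is generated by $\sigma_1,\dots,\sigma_{n-1}$ subject to the relations $\sigma_i\sigma_j=\sigma_j\sigma_i$ if $|i-j|\ge 2$, $1\le i,j\le n-1$, and $\sigma_i\sigma_{i+1}\sigma_i=\sigma_{i+1}\sigma_i\sigma_{i+1}$ for $1\le i\le n-2$. The pure braid group $P_n$ is the kernel of the surjection $\pi\colon B_n\to S_n$ sending $\sigma_i$ to the transposition $(i,i+1)$. For a group $\Gamma$, $\Gamma^{\mathrm{Ab}}$ denotes its Abelianisation. For $X\subset\Gamma$, $\Gamma$ is generated by $X$ if the subgroup generated by $X$ is $\Gamma$, and normally generated by $X$ if the normal closure of $X$ in $\Gamma$ is $\Gamma$. $\operatorname{G}(\Gamma)$ (resp. $\operatorname{NG}(\Gamma)$) is the minimal cardinality of a subset $X\subset\Gamma$ such that $\Gamma$ is generated (resp. normally generated) by $X$. *)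

theory Defs
  imports "HOL-Algebra.Sym_Groups" "HOL-Library.Extended_Nat"
begin

section \<open>Groups given by generators and relations\<close>

text \<open>The letter \<open>(x, True)\<close> is the generator \<open>x\<close>, the letter \<open>(x, False)\<close> its inverse.\<close>

type_synonym 'a word = "('a \<times> bool) list"

definition words :: "'a set \<Rightarrow> 'a word set" where
  "words S = lists (S \<times> UNIV)"

text \<open>The least congruence on words over \<open>S\<close> that contains the free cancellations and the
  relations \<open>R\<close>; a pair \<open>(u, v)\<close> in \<open>R\<close> stands for the relation \<open>u = v\<close>.\<close>

inductive_set pres_rel :: "'a set \<Rightarrow> ('a word \<times> 'a word) set \<Rightarrow> ('a word \<times> 'a word) set"
  for S R where
    refl: "u \<in> words S \<Longrightarrow> (u, u) \<in> pres_rel S R"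
  | sym: "(u, v) \<in> pres_rel S R \<Longrightarrow> (v, u) \<in> pres_rel S R"
  | trans: "(u, v) \<in> pres_rel S R \<Longrightarrow> (v, w) \<in> pres_rel S R \<Longrightarrow> (u, w) \<in> pres_rel S R"
  | append: "(u, u') \<in> pres_rel S R \<Longrightarrow> (v, v') \<in> pres_rel S R \<Longrightarrow>
      (u @ v, u' @ v') \<in> pres_rel S R"
  | cancel: "x \<in> S \<Longrightarrow> ([(x, b), (x, \<not> b)], []) \<in> pres_rel S R"
  | relation: "(u, v) \<in> R \<Longrightarrow> u \<in> words S \<Longrightarrow> v \<in> words S \<Longrightarrow> (u, v) \<in> pres_rel S R"

definition presented_group :: "'a set \<Rightarrow> ('a word \<times> 'a word) set \<Rightarrow> 'a word set monoid" where
  "presented_group S R =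
    \<lparr> carrier = words S // pres_rel S R,
      mult = (\<lambda>X Y. \<Union>u\<in>X. \<Union>v\<in>Y. pres_rel S R `` {u @ v}),
      one = pres_rel S R `` {[]} \<rparr>"

definition pres_gen :: "'a set \<Rightarrow> ('a word \<times> 'a word) set \<Rightarrow> 'a \<Rightarrow> 'a word set" where
  "pres_gen S R x = pres_rel S R `` {[(x, True)]}"

lemma pres_rel_words: "(u, v) \<in> pres_rel S R \<Longrightarrow> u \<in> words S \<and> v \<in> words S"
  by (induction rule: pres_rel.induct) (auto simp: words_def)

lemma equiv_pres_rel: "equiv (words S) (pres_rel S R)"
proof (rule equivI)
  show "pres_rel S R \<subseteq> words S \<times> words S"
  proof
    fix p assume "p \<in> pres_rel S R"
    then show "p \<in> words S \<times> words S" using pres_rel_words[of "fst p" "snd p"] by (cases p) simp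
  qed
  show "refl_on (words S) (pres_rel S R)"
    by (auto simp: refl_on_def intro: pres_rel.refl)
  show "Relation.sym (pres_rel S R)"
    by (auto intro: symI pres_rel.sym)
  show "Relation.trans (pres_rel S R)"
    by (rule transI) (rule pres_rel.trans)
qed

lemma presented_group_mult:
  assumes "u \<in> words S" "v \<in> words S"
  shows "(pres_rel S R `` {u}) \<otimes>\<^bsub>presented_group S R\<^esub> (pres_rel S R `` {v})
    = pres_rel S R `` {u @ v}"
proof -
  let ?r = "pres_rel S R"
  have class_append: "?r `` {u' @ v'} = ?r `` {u @ v}" if "u' \<in> ?r `` {u}" "v' \<in> ?r `` {v}" for u' v'
  proof (rule equiv_class_eq[OF equiv_pres_rel, symmetric])
    show "(u @ v, u' @ v') \<in> ?r" using that by (intro pres_rel.append) simp_all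
  qed
  have "u \<in> ?r `` {u}" "v \<in> ?r `` {v}"
    using assms by (simp_all add: pres_rel.refl)
  then have nonempty: "?r `` {u} \<noteq> {}" "?r `` {v} \<noteq> {}"
    by (metis empty_iff)+
  have "(?r `` {u}) \<otimes>\<^bsub>presented_group S R\<^esub> (?r `` {v})
      = (\<Union>u'\<in>?r `` {u}. \<Union>v'\<in>?r `` {v}. ?r `` {u' @ v'})"
    by (simp only: presented_group_def monoid.simps)
  also have "\<dots> = (\<Union>u'\<in>?r `` {u}. \<Union>v'\<in>?r `` {v}. ?r `` {u @ v})"
    by (intro SUP_cong[OF HOL.refl] class_append)
  also have "\<dots> = ?r `` {u @ v}"
    by (simp only: UN_constant nonempty if_False)
  finally show ?thesis .
qed

lemma presented_group_inverse:
  assumes "u \<in> words S"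
  shows "\<exists>v\<in>words S. (v @ u, []) \<in> pres_rel S R"
  using assms
proof (induction u)
  case Nil
  show ?case by (rule bexI[of _ "[]"]) (auto simp: words_def intro: pres_rel.refl)
next
  case (Cons a u)
  obtain x b where a: "a = (x, b)" by (cases a)
  have u: "u \<in> words S" and x: "x \<in> S"
    using Cons.prems by (auto simp: words_def a)
  obtain v where v: "v \<in> words S" "(v @ u, []) \<in> pres_rel S R"
    using Cons.IH u by blast
  have "([(x, \<not> b), (x, b)], []) \<in> pres_rel S R"
    using pres_rel.cancel[OF x, of "\<not> b"] by simp
  then have "(v @ [(x, \<not> b), (x, b)] @ u, v @ [] @ u) \<in> pres_rel S R"
    using u v(1) by (intro pres_rel.append pres_rel.refl)
  then have "((v @ [(x, \<not> b)]) @ a # u, []) \<in> pres_rel S R"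
    using v(2) by (auto simp: a intro: pres_rel.trans)
  moreover have "v @ [(x, \<not> b)] \<in> words S"
    using v(1) x by (auto simp: words_def)
  ultimately show ?case by blast
qed

lemma presented_group_is_group: "group (presented_group S R)"
proof (rule groupI)
  have nil: "[] \<in> words S" by (simp add: words_def)
  have app: "u @ v \<in> words S" if "u \<in> words S" "v \<in> words S" for u v
    using that by (auto simp: words_def)
  have one: "\<one>\<^bsub>presented_group S R\<^esub> = pres_rel S R `` {[]}"
    by (simp add: presented_group_def)
  have inG: "pres_rel S R `` {u} \<in> carrier (presented_group S R)" if "u \<in> words S" for u
    using that by (simp add: presented_group_def quotientI)
  have rep: "\<exists>u\<in>words S. X = pres_rel S R `` {u}" if "X \<in> carrier (presented_group S R)" for X
    using that by (auto simp: presented_group_def elim!: quotientE)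
  show "\<one>\<^bsub>presented_group S R\<^esub> \<in> carrier (presented_group S R)"
    using inG[OF nil] by (simp add: one)
  fix X assume "X \<in> carrier (presented_group S R)"
  then obtain u where u: "u \<in> words S" "X = pres_rel S R `` {u}" using rep by blast
  show "\<one>\<^bsub>presented_group S R\<^esub> \<otimes>\<^bsub>presented_group S R\<^esub> X = X"
    using presented_group_mult[OF nil u(1)] by (simp add: one u(2))
  obtain v where v: "v \<in> words S" "(v @ u, []) \<in> pres_rel S R"
    using presented_group_inverse[OF u(1)] by blast
  have "(pres_rel S R `` {v}) \<otimes>\<^bsub>presented_group S R\<^esub> X = \<one>\<^bsub>presented_group S R\<^esub>"
    using presented_group_mult[OF v(1) u(1)] equiv_class_eq[OF equiv_pres_rel v(2)]
    by (simp add: one u(2))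
  then show "\<exists>Y\<in>carrier (presented_group S R).
      Y \<otimes>\<^bsub>presented_group S R\<^esub> X = \<one>\<^bsub>presented_group S R\<^esub>"
    using inG[OF v(1)] by blast
  fix Y assume "Y \<in> carrier (presented_group S R)"
  then obtain v where v: "v \<in> words S" "Y = pres_rel S R `` {v}" using rep by blast
  show "X \<otimes>\<^bsub>presented_group S R\<^esub> Y \<in> carrier (presented_group S R)"
    using presented_group_mult[OF u(1) v(1)] inG[OF app[OF u(1) v(1)]] by (simp add: u(2) v(2))
  fix Z assume "Z \<in> carrier (presented_group S R)"
  then obtain w where w: "w \<in> words S" "Z = pres_rel S R `` {w}" using rep by blast
  show "X \<otimes>\<^bsub>presented_group S R\<^esub> Y \<otimes>\<^bsub>presented_group S R\<^esub> Z
      = X \<otimes>\<^bsub>presented_group S R\<^esub> (Y \<otimes>\<^bsub>presented_group S R\<^esub> Z)"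
    using u v w by (simp add: presented_group_mult app)
qed


section \<open>Braid groups and pure braid groups\<close>

definition braid_relations :: "nat \<Rightarrow> (nat word \<times> nat word) set" where
  "braid_relations n =
    {([(i, True), (j, True)], [(j, True), (i, True)]) | i j.
      i \<in> {1..n - 1} \<and> j \<in> {1..n - 1} \<and> \<bar>int i - int j\<bar> \<ge> 2} \<union>
    {([(i, True), (i + 1, True), (i, True)], [(i + 1, True), (i, True), (i + 1, True)]) | i.
      i \<in> {1..n - 2}}"

definition braid_group :: "nat \<Rightarrow> nat word set monoid" where
  "braid_group n = presented_group {1..n - 1} (braid_relations n)"

definition braid_gen :: "nat \<Rightarrow> nat \<Rightarrow> nat word set" where
  "braid_gen n i = pres_gen {1..n - 1} (braid_relations n) i"

text \<open>A generator and its inverse go to the same transposition. On a class of words the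
  permutation does not depend on the representative (\<open>word_perm_eq\<close> below).\<close>

fun word_perm :: "nat word \<Rightarrow> nat \<Rightarrow> nat" where
  "word_perm [] = id"
| "word_perm ((i, b) # w) = transpose i (i + 1) \<circ> word_perm w"

definition braid_perm :: "nat word set \<Rightarrow> nat \<Rightarrow> nat" where
  "braid_perm X = the_elem (word_perm ` X)"

definition pure_braids :: "nat \<Rightarrow> nat word set set" where
  "pure_braids n = kernel (braid_group n) (sym_group n) braid_perm"

definition pure_braid_group :: "nat \<Rightarrow> nat word set monoid" where
  "pure_braid_group n = (braid_group n)\<lparr>carrier := pure_braids n\<rparr>"

lemma word_perm_append: "word_perm (u @ v) = word_perm u \<circ> word_perm v"
  by (induction u rule: word_perm.induct) (auto simp: comp_assoc)

lemma word_perm_eq: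
  "(u, v) \<in> pres_rel {1..n - 1} (braid_relations n) \<Longrightarrow> word_perm u = word_perm v"
proof (induction rule: pres_rel.induct)
  case (relation u v)
  have far: "transpose i (i + 1) \<circ> transpose j (j + 1) = transpose j (j + 1) \<circ> transpose i (i + 1)"
    if "\<bar>int i - int j\<bar> \<ge> 2" for i j
  proof -
    from that have "i \<noteq> j" "i \<noteq> j + 1" "j \<noteq> i + 1" by linarith+
    then show ?thesis by (intro ext) (simp add: transpose_def)
  qed
  have near: "transpose i (i + 1) \<circ> (transpose (i + 1) (i + 2) \<circ> transpose i (i + 1))
      = transpose (i + 1) (i + 2) \<circ> (transpose i (i + 1) \<circ> transpose (i + 1) (i + 2))" for i :: nat
    by (intro ext) (simp add: transpose_def)
  from relation(1) show ?case
    unfolding braid_relations_def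
  proof (elim UnE CollectE exE conjE)
    fix i j
    assume "(u, v) = ([(i, True), (j, True)], [(j, True), (i, True)])" "\<bar>int i - int j\<bar> \<ge> 2"
    then show ?thesis using far[of i j] by simp
  next
    fix i
    assume "(u, v) = ([(i, True), (i + 1, True), (i, True)], [(i + 1, True), (i, True), (i + 1, True)])"
    then show ?thesis using near[of i] by simp
  qed
qed (auto simp: word_perm_append)

lemma word_perm_permutes: "u \<in> words {1..n - 1} \<Longrightarrow> word_perm u permutes {1..n}"
proof (induction u rule: word_perm.induct)
  case 1
  show ?case by (simp only: word_perm.simps permutes_id)
next
  case (2 i b w)
  then have "i \<in> {1..n}" "i + 1 \<in> {1..n}" "w \<in> words {1..n - 1}"
    by (auto simp: words_def)
  then show ?case
    unfolding word_perm.simps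
    by (blast intro: permutes_compose[OF "2.IH"] permutes_swap_id)
qed

lemma braid_perm_class:
  assumes "u \<in> words {1..n - 1}"
  shows "braid_perm (pres_rel {1..n - 1} (braid_relations n) `` {u}) = word_perm u"
proof -
  let ?C = "pres_rel {1..n - 1} (braid_relations n) `` {u}"
  have "u \<in> ?C" using pres_rel.refl[OF assms] by blast
  moreover have "word_perm v = word_perm u" if "v \<in> ?C" for v
    using that word_perm_eq[of u v n] by simp
  ultimately have "word_perm ` ?C = {word_perm u}" by blast
  then show ?thesis by (simp add: braid_perm_def)
qed

lemma braid_group_is_group: "group (braid_group n)"
  by (simp add: braid_group_def presented_group_is_group)

lemma braid_gen_in_carrier: "i \<in> {1..n - 1} \<Longrightarrow> braid_gen n i \<in> carrier (braid_group n)"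
  unfolding braid_group_def braid_gen_def pres_gen_def presented_group_def partial_object.simps
  by (rule quotientI) (simp add: words_def)

lemma braid_perm_gen:
  assumes "i \<in> {1..n - 1}"
  shows "braid_perm (braid_gen n i) = transpose i (i + 1)"
proof -
  have "[(i, True)] \<in> words {1..n - 1}" using assms by (simp add: words_def)
  from braid_perm_class[OF this] show ?thesis
    by (simp add: braid_gen_def pres_gen_def)
qed

lemma braid_perm_hom: "braid_perm \<in> hom (braid_group n) (sym_group n)"
proof (rule homI)
  let ?r = "pres_rel {1..n - 1} (braid_relations n)"
  have rep: "\<exists>u\<in>words {1..n - 1}. X = ?r `` {u}" if "X \<in> carrier (braid_group n)" for X
    using that by (auto simp: braid_group_def presented_group_def elim!: quotientE)
  fix X assume "X \<in> carrier (braid_group n)"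
  then obtain u where u: "u \<in> words {1..n - 1}" "X = ?r `` {u}" using rep by blast
  show "braid_perm X \<in> carrier (sym_group n)"
    using word_perm_permutes[OF u(1)] braid_perm_class[OF u(1)]
    by (simp add: u(2) sym_group_carrier)
  fix Y assume "Y \<in> carrier (braid_group n)"
  then obtain v where v: "v \<in> words {1..n - 1}" "Y = ?r `` {v}" using rep by blast
  have "u @ v \<in> words {1..n - 1}" using u(1) v(1) by (auto simp: words_def)
  then show "braid_perm (X \<otimes>\<^bsub>braid_group n\<^esub> Y)
      = braid_perm X \<otimes>\<^bsub>sym_group n\<^esub> braid_perm Y"
    unfolding u(2) v(2) braid_group_def presented_group_mult[OF u(1) v(1)]
      braid_perm_class[OF u(1)] braid_perm_class[OF v(1)] sym_group_mult word_perm_append[symmetric]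
    by (rule braid_perm_class)
qed

lemma pure_braids_normal: "pure_braids n \<lhd> braid_group n"
proof -
  have "group_hom (braid_group n) (sym_group n) braid_perm"
    by (intro group_hom.intro group_hom_axioms.intro braid_group_is_group sym_group_is_group
        braid_perm_hom)
  then show ?thesis unfolding pure_braids_def by (rule group_hom.normal_kernel)
qed

lemma pure_braid_group_is_group: "group (pure_braid_group n)"
  unfolding pure_braid_group_def
  by (rule group.subgroup_imp_group[OF braid_group_is_group
        normal_imp_subgroup[OF pure_braids_normal]])


section \<open>Abelianisation and numbers of generators\<close>

definition abelianisation :: "('a, 'b) monoid_scheme \<Rightarrow> 'a set monoid" where
  "abelianisation G = G Mod (derived G (carrier G))"

definition normal_closure :: "('a, 'b) monoid_scheme \<Rightarrow> 'a set \<Rightarrow> 'a set" where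
  "normal_closure G X = \<Inter>{N. N \<lhd> G \<and> X \<subseteq> N}"

text \<open>The infimum is over finite sets only, so it is a minimum, or \<open>\<infinity>\<close> if there is no finite
  (normally) generating set.\<close>

definition gen_number :: "('a, 'b) monoid_scheme \<Rightarrow> enat" where
  "gen_number G =
    (INF X \<in> {X. X \<subseteq> carrier G \<and> finite X \<and> generate G X = carrier G}. enat (card X))"

definition normal_gen_number :: "('a, 'b) monoid_scheme \<Rightarrow> enat" where
  "normal_gen_number G =
    (INF X \<in> {X. X \<subseteq> carrier G \<and> finite X \<and> normal_closure G X = carrier G}. enat (card X))"

end

theory Submission
  imports Defs
begin

text \<open>
  Generation of \<open>B\<^sub>n\<close>. The product \<open>\<delta> = \<sigma>\<^sub>1 \<cdots> \<sigma>\<^bsub>n-1\<^esub>\<close> satisfies \<open>\<delta> \<sigma>\<^sub>i \<delta>\<inverse> = \<sigma>\<^bsub>i+1\<^esub>\<close>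
  (\<open>ascent_shift\<close>), so \<open>\<sigma>\<^sub>1\<close> and \<open>\<delta>\<close> generate \<open>B\<^sub>n\<close>, and for \<open>n = 2\<close> they coincide. One element is not
  enough for \<open>n \<ge> 3\<close>, since a cyclic group is commutative and the image \<open>S\<^sub>n\<close> is not. The braid
  relation makes \<open>\<sigma>\<^sub>i\<close> and \<open>\<sigma>\<^bsub>i+1\<^esub>\<close> conjugate, so \<open>\<sigma>\<^sub>1\<close> alone generates normally.

  For \<open>P\<^sub>n\<close> let \<open>d\<close> be the number of pairs of strands. Since normal generation is weaker than
  generation, and generators of a group yield generators of its quotients, the three numbers are
  squeezed to \<open>d\<close> (\<open>generator_numbers_eqI\<close>) by two facts.

  Upper bound: \<open>P\<^sub>n\<close> is generated by one full twist \<open>A\<^bsub>ij\<^esub>\<close> for each pair of strands. The twist is the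
  square of a half twist \<open>a\<^bsub>ij\<^esub>\<close>, a conjugate of a standard generator, and each \<open>\<sigma>\<^sub>k\<close> conjugates, in one
  of the two directions, every \<open>a\<^bsub>ij\<^esub>\<close> to a half twist. As \<open>\<sigma>\<^sub>k\<^sup>2\<close> is itself one of the twists,
  the subgroup \<open>H\<close> generated by the twists is normal (\<open>twist_subgroup_normal\<close>). In \<open>B\<^sub>n/H\<close> the
  generators become involutions, so that the classical normal form of the Coxeter group of type
  \<open>A\<^bsub>n-1\<^esub>\<close> applies (\<open>level_coset\<close>): each class has a representative that its permutation determines,
  and therefore an element of \<open>P\<^sub>n\<close> lies in \<open>H\<close> (\<open>kernel_perm_generated\<close>).

  Lower bound: the pairwise linking numbers modulo 2 map \<open>P\<^sub>n\<close> onto the elementary abelian group of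
  order \<open>2\<^sup>d\<close> (\<open>odd_linking_surj\<close>), the twist \<open>A\<^bsub>ij\<^esub>\<close> going to the basis vector of the pair. In an abelian
  image a normally generating set becomes a generating set, and \<open>k\<close> elements of exponent 2
  generate at most \<open>2\<^sup>k\<close> elements (\<open>card_le_normal_gen_number\<close>). The map factors through the
  abelianisation, to which the same bound applies.
\<close>

section \<open>Numbers of generators\<close>

lemma gen_number_le:
  assumes "X \<subseteq> carrier G" "finite X" "generate G X = carrier G" "card X \<le> k"
  shows "gen_number G \<le> enat k"
proof -
  have "gen_number G \<le> enat (card X)"
    unfolding gen_number_def using assms(1-3) by (intro INF_lower) auto
  then show ?thesis using assms(4) by (meson enat_ord_simps(1) order_trans)
qed

lemma (in group) normal_closure_generating:
  assumes "X \<subseteq> carrier G" "generate G X = carrier G"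
  shows "normal_closure G X = carrier G"
proof
  show "normal_closure G X \<subseteq> carrier G"
    unfolding normal_closure_def using normal_self assms(1) by blast
  show "carrier G \<subseteq> normal_closure G X"
    unfolding normal_closure_def
  proof (rule Inter_greatest)
    fix N assume "N \<in> {N. N \<lhd> G \<and> X \<subseteq> N}"
    then show "carrier G \<subseteq> N"
      using generate_subgroup_incl[of X N] normal_imp_subgroup[of N G] assms(2) by simp
  qed
qed

lemma (in group) normal_gen_number_le_gen_number: "normal_gen_number G \<le> gen_number G"
  unfolding normal_gen_number_def gen_number_def
  using normal_closure_generating by (intro INF_superset_mono) auto

lemma (in group_hom) gen_number_epi_le:
  assumes "h ` carrier G = carrier H"
  shows "gen_number H \<le> gen_number G"
  unfolding gen_number_def[of G]
proof (rule INF_greatest)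
  fix X assume "X \<in> {X. X \<subseteq> carrier G \<and> finite X \<and> generate G X = carrier G}"
  then have X: "X \<subseteq> carrier G" "finite X" "generate G X = carrier G" by auto
  show "gen_number H \<le> enat (card X)"
  proof (rule gen_number_le)
    show "generate H (h ` X) = carrier H"
      using generate_img[OF X(1)] X(3) assms by simp
    show "h ` X \<subseteq> carrier H" using X(1) assms by blast
    show "card (h ` X) \<le> card X" by (rule card_image_le[OF X(2)])
  qed (simp add: X(2))
qed

text \<open>The trivial subgroup is normal, so the empty set normally generates only the trivial group.\<close>

lemma (in group) one_le_normal_gen_number:
  assumes "carrier G \<noteq> {\<one>}"
  shows "1 \<le> normal_gen_number G"
  unfolding normal_gen_number_def
proof (rule INF_greatest)
  fix X assume "X \<in> {X. X \<subseteq> carrier G \<and> finite X \<and> normal_closure G X = carrier G}"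
  then have X: "finite X" "normal_closure G X = carrier G" by auto
  have "normal_closure G {} \<subseteq> {\<one>}"
    unfolding normal_closure_def using one_is_normal by blast
  moreover have "\<one> \<in> carrier G" by simp
  ultimately have "X \<noteq> {}" using X(2) assms by blast
  with X(1) have "1 \<le> card X" by (simp add: Suc_leI card_gt_0_iff)
  then show "1 \<le> enat (card X)" by (simp add: one_enat_def)
qed

text \<open>With at most one generator the group would be cyclic, hence commutative.\<close>

lemma (in group) two_le_gen_number:
  assumes "x \<in> carrier G" "y \<in> carrier G" "x \<otimes> y \<noteq> y \<otimes> x"
  shows "2 \<le> gen_number G"
  unfolding gen_number_def
proof (rule INF_greatest)
  fix X assume "X \<in> {X. X \<subseteq> carrier G \<and> finite X \<and> generate G X = carrier G}"
  then have X: "X \<subseteq> carrier G" "finite X" "generate G X = carrier G" by auto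
  have "\<not> X \<subseteq> {a}" if a: "a \<in> carrier G" for a
  proof
    assume "X \<subseteq> {a}"
    then have "carrier G \<subseteq> generate G {a}" using mono_generate X(3) by blast
    then have "x \<in> generate G {a}" "y \<in> generate G {a}" using assms(1,2) by auto
    then obtain k l :: int where "x = a [^] k" "y = a [^] l"
      unfolding generate_pow[OF a] by blast
    then have "x \<otimes> y = y \<otimes> x" using a by (simp add: int_pow_mult[symmetric] add.commute)
    with assms(3) show False by blast
  qed
  moreover have "\<exists>a\<in>carrier G. X \<subseteq> {a}" if "card X \<le> 1"
  proof (cases "X = {}")
    case True
    then show ?thesis using one_closed by blast
  next
    case False
    then have "card X = 1" using that X(2) by (simp add: card_gt_0_iff le_antisym Suc_leI)
    then show ?thesis using X(1) by (auto simp: card_1_singleton_iff)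
  qed
  ultimately have "\<not> card X \<le> 1" by blast
  then show "2 \<le> enat (card X)" by (simp add: numeral_eq_enat)
qed

section \<open>Elementary abelian 2-groups as a lower bound\<close>

text \<open>The vector space over the field with two elements that has \<open>D\<close> as a basis, a vector being
  identified with its support.\<close>

definition parity_group :: "'b set \<Rightarrow> 'b set monoid" where
  "parity_group D = \<lparr>carrier = Pow D, mult = sym_diff, one = {}\<rparr>"

lemma parity_group_simps [simp]:
  "carrier (parity_group D) = Pow D"
  "x \<otimes>\<^bsub>parity_group D\<^esub> y = sym_diff x y"
  "\<one>\<^bsub>parity_group D\<^esub> = {}"
  by (simp_all add: parity_group_def)

lemma comm_group_parity_group: "comm_group (parity_group D)"
  by (rule comm_groupI) auto

lemma parity_group_inv: "x \<subseteq> D \<Longrightarrow> inv\<^bsub>parity_group D\<^esub> x = x"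
  by (rule group.inv_equality[OF comm_group.axioms(2)[OF comm_group_parity_group]]) auto

lemma subgroup_parity_groupI:
  assumes "V \<subseteq> Pow D" "{} \<in> V" "\<And>x y. x \<in> V \<Longrightarrow> y \<in> V \<Longrightarrow> sym_diff x y \<in> V"
  shows "subgroup V (parity_group D)"
proof (rule subgroup.intro)
  show "inv\<^bsub>parity_group D\<^esub> x \<in> V" if "x \<in> V" for x
    using that assms(1) by (subst parity_group_inv) auto
qed (use assms in auto)

text \<open>Adjoining \<open>y\<close> to a subgroup \<open>V\<close> of exponent 2 adds only the coset of \<open>y\<close>, which at most doubles
  the order.\<close>

lemma parity_group_span_bound:
  assumes "finite Y" "Y \<subseteq> Pow D"
  shows "\<exists>V. subgroup V (parity_group D) \<and> Y \<subseteq> V \<and> finite V \<and> card V \<le> 2 ^ card Y"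
  using assms
proof (induction Y rule: finite_induct)
  case empty
  have "subgroup {{}} (parity_group D)" by (rule subgroup_parity_groupI) auto
  then show ?case by (intro exI[of _ "{{}}"]) auto
next
  case (insert y Y)
  then obtain V where V: "subgroup V (parity_group D)" "Y \<subseteq> V" "finite V" "card V \<le> 2 ^ card Y"
    by auto
  have closed: "sym_diff a b \<in> V" if "a \<in> V" "b \<in> V" for a b
    using subgroup.m_closed[OF V(1) that] by simp
  have zero: "{} \<in> V" using subgroup.one_closed[OF V(1)] by simp
  \<comment> \<open>the coset of \<open>y\<close> together with \<open>V\<close> is already closed, because \<open>y + y = 0\<close>\<close>
  let ?W = "V \<union> sym_diff y ` V"
  have cancel: "sym_diff (sym_diff y a) (sym_diff y b) = sym_diff a b"
    "sym_diff a (sym_diff y b) = sym_diff y (sym_diff a b)"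
    "sym_diff (sym_diff y a) b = sym_diff y (sym_diff a b)" for a b by auto
  have "subgroup ?W (parity_group D)"
  proof (rule subgroup_parity_groupI)
    show "?W \<subseteq> Pow D" using insert.prems subgroup.subset[OF V(1)] by auto
    show "{} \<in> ?W" using zero by blast
    fix a b assume "a \<in> ?W" "b \<in> ?W"
    then consider "a \<in> V" "b \<in> V" | c where "a = sym_diff y c" "c \<in> V" "b \<in> V"
      | d where "a \<in> V" "b = sym_diff y d" "d \<in> V"
      | c d where "a = sym_diff y c" "c \<in> V" "b = sym_diff y d" "d \<in> V"
      by blast
    then show "sym_diff a b \<in> ?W"
    proof cases
      case 1
      then show ?thesis using closed by blast
    next
      case 2
      then show ?thesis using closed[of c b] unfolding 2(1) cancel(3) by blast
    next
      case 3
      then show ?thesis using closed[of a d] unfolding 3(2) cancel(2) by blast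
    next
      case 4
      then show ?thesis using closed[of c d] unfolding 4(1,3) cancel(1) by blast
    qed
  qed
  moreover have "insert y Y \<subseteq> ?W" using V(2) zero by force
  moreover have "card ?W \<le> 2 ^ card (insert y Y)"
    using card_Un_le[of V "sym_diff y ` V"] card_image_le[OF V(3), of "sym_diff y"] V(4) insert.hyps
    by simp
  ultimately show ?case using V(3) by blast
qed

text \<open>The preimage of the span of \<open>f ` X\<close> is a normal subgroup because the target is abelian. If \<open>X\<close>
  normally generates, that preimage is everything, and the span has all \<open>2 ^ card D\<close> elements.\<close>

lemma card_le_normal_gen_number:
  assumes "group_hom G (parity_group D) f" "f ` carrier G = Pow D" "finite D"
  shows "enat (card D) \<le> normal_gen_number G"
  unfolding normal_gen_number_def
proof (rule INF_greatest)
  interpret group_hom G "parity_group D" f by fact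
  fix X assume "X \<in> {X. X \<subseteq> carrier G \<and> finite X \<and> normal_closure G X = carrier G}"
  then have X: "X \<subseteq> carrier G" "finite X" "normal_closure G X = carrier G" by auto
  have "f ` X \<subseteq> Pow D" using X(1) assms(2) by blast
  then obtain V where V: "subgroup V (parity_group D)" "f ` X \<subseteq> V" "finite V"
    "card V \<le> 2 ^ card (f ` X)"
    using parity_group_span_bound[of "f ` X" D] X(2) by blast
  let ?N = "{g \<in> carrier G. f g \<in> V}"
  have fD: "f g \<subseteq> D" if "g \<in> carrier G" for g using that assms(2) by blast
  have closed: "sym_diff a b \<in> V" if "a \<in> V" "b \<in> V" for a b
    using subgroup.m_closed[OF V(1) that] by simp
  have "?N \<lhd> G"
  proof (rule G.normal_invI)
    show "subgroup ?N G"
    proof (rule subgroup.intro)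
      show "inv\<^bsub>G\<^esub> x \<in> ?N" if "x \<in> ?N" for x
        using that fD by (simp add: parity_group_inv)
      show "x \<otimes>\<^bsub>G\<^esub> y \<in> ?N" if "x \<in> ?N" "y \<in> ?N" for x y
        using that closed[of "f x" "f y"] by simp
    qed (use subgroup.one_closed[OF V(1)] in auto)
    fix x g assume x: "x \<in> carrier G" and g: "g \<in> ?N"
    then have "f (x \<otimes>\<^bsub>G\<^esub> g \<otimes>\<^bsub>G\<^esub> inv\<^bsub>G\<^esub> x) = f g" using fD by (auto simp: parity_group_inv)
    with x g show "x \<otimes>\<^bsub>G\<^esub> g \<otimes>\<^bsub>G\<^esub> inv\<^bsub>G\<^esub> x \<in> ?N" by simp
  qed
  moreover have "X \<subseteq> ?N" using X(1) V(2) by blast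
  ultimately have "carrier G \<subseteq> ?N" using X(3) unfolding normal_closure_def by blast
  then have "f ` carrier G \<subseteq> V" by blast
  then have "Pow D \<subseteq> V" by (simp only: assms(2))
  then have "2 ^ card D \<le> card V" using card_mono[OF V(3)] card_Pow[OF assms(3)] by metis
  also have "\<dots> \<le> 2 ^ card X"
    using V(4) card_image_le[OF X(2), of f] by (meson one_le_numeral order_trans power_increasing)
  finally have "card D \<le> card X" by simp
  then show "enat (card D) \<le> enat (card X)" by simp
qed

lemma (in group_hom) abelianisation_universal:
  assumes "comm_group H"
  obtains g where "group_hom (abelianisation G) H g" "g ` carrier (abelianisation G) = h ` carrier G"
proof -
  interpret H': comm_group H by fact
  have "h ` carrier G \<subseteq> carrier H" by auto
  then have "h ` derived G (carrier G) = {\<one>\<^bsub>H\<^esub>}"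
    using derived_img[OF order_refl] H'.derived_eq_singleton by simp
  then have "derived G (carrier G) \<subseteq> kernel G H h"
    using G.derived_in_carrier[OF order_refl] by (auto simp: kernel_def)
  then obtain g where g: "g \<in> hom (abelianisation G) H"
    "\<And>x. x \<in> carrier G \<Longrightarrow> g (derived G (carrier G) #>\<^bsub>G\<^esub> x) = h x"
    unfolding abelianisation_def
    using FactGroup_universal_kernel[OF G.derived_self_is_normal] by blast
  have "group_hom (abelianisation G) H g"
    using g(1) G.derived_quot_is_group
    by (simp add: group_hom_def group_hom_axioms_def abelianisation_def)
  moreover have "g ` carrier (abelianisation G) = h ` carrier G"
    unfolding abelianisation_def carrier_FactGroup image_image using g(2) by (intro image_cong) auto
  ultimately show thesis using that by blast
qed

lemma (in group) gen_number_abelianisation_le: "gen_number (abelianisation G) \<le> gen_number G"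
proof (rule group_hom.gen_number_epi_le)
  interpret D: normal "derived G (carrier G)" G by (rule derived_self_is_normal)
  show "group_hom G (abelianisation G) (\<lambda>x. derived G (carrier G) #> x)"
    using D.r_coset_hom_Mod derived_quot_is_group
    by (simp add: group_hom_def group_hom_axioms_def abelianisation_def)
qed (simp add: abelianisation_def carrier_FactGroup)

text \<open>Normal generation is weaker than generation and a quotient needs no more generators than the
  group, so the lower bound need only be checked for normal generation of \<open>G\<close> and of its
  abelianisation, and the upper bound only for generation of \<open>G\<close>.\<close>

lemma generator_numbers_eqI:
  assumes f: "group_hom G (parity_group D) f" "f ` carrier G = Pow D" "finite D"
    and X: "X \<subseteq> carrier G" "finite X" "generate G X = carrier G" "card X \<le> card D"
  shows "normal_gen_number G = enat (card D)" "gen_number G = enat (card D)"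
    "gen_number (abelianisation G) = enat (card D)"
proof -
  interpret f: group_hom G "parity_group D" f by fact
  obtain g where g: "group_hom (abelianisation G) (parity_group D) g"
    "g ` carrier (abelianisation G) = Pow D"
    using f.abelianisation_universal[OF comm_group_parity_group] f(2) by metis
  interpret g: group_hom "abelianisation G" "parity_group D" g by fact
  note upper = gen_number_le[OF X]
  show "normal_gen_number G = enat (card D)" "gen_number G = enat (card D)"
    using card_le_normal_gen_number[OF f] f.G.normal_gen_number_le_gen_number upper by order+
  show "gen_number (abelianisation G) = enat (card D)"
    using card_le_normal_gen_number[OF g f(3)] g.G.normal_gen_number_le_gen_number
      f.G.gen_number_abelianisation_le upper by order
qed

section \<open>Half twists\<close>

text \<open>What the arguments use of \<open>B\<^sub>n\<close> with \<open>\<pi>\<close>: generators that satisfy Artin's relations, and a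
  homomorphism to permutations (composed right to left) that sends them to adjacent transpositions.\<close>

locale artin_generators = group G for G (structure) +
  fixes n :: nat and s :: "nat \<Rightarrow> 'a" and perm :: "'a \<Rightarrow> nat \<Rightarrow> nat"
  assumes s_closed: "i \<in> {1..<n} \<Longrightarrow> s i \<in> carrier G"
    and far: "i \<in> {1..<n} \<Longrightarrow> j \<in> {1..<n} \<Longrightarrow> i + 2 \<le> j \<Longrightarrow> s i \<otimes> s j = s j \<otimes> s i"
    and near: "1 \<le> i \<Longrightarrow> i + 1 < n \<Longrightarrow>
      s i \<otimes> s (i + 1) \<otimes> s i = s (i + 1) \<otimes> s i \<otimes> s (i + 1)"
    and generated: "generate G (s ` {1..<n}) = carrier G"
    and perm_mult: "x \<in> carrier G \<Longrightarrow> y \<in> carrier G \<Longrightarrow> perm (x \<otimes> y) = perm x \<circ> perm y"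
    and perm_one: "perm \<one> = id"
    and perm_s: "i \<in> {1..<n} \<Longrightarrow> perm (s i) = transpose i (i + 1)"

lemma (in group) cancel_inv_left:
  assumes "x \<in> carrier G" "y \<in> carrier G"
  shows "x \<otimes> (inv x \<otimes> y) = y" "inv x \<otimes> (x \<otimes> y) = y"
  using assms by (simp_all add: m_assoc[symmetric])

text \<open>Conjugation of \<open>a\<close> to \<open>a'\<close> by \<open>x\<close> is expressed as \<open>x a = a' x\<close>: in this form it is compatible with
  products and inverses, and \<open>a' = a\<close> gives commutation.\<close>

lemma (in group) intertwine_mult:
  assumes "x \<otimes> a = a' \<otimes> x" "x \<otimes> b = b' \<otimes> x"
    and "x \<in> carrier G" "a \<in> carrier G" "b \<in> carrier G" "a' \<in> carrier G" "b' \<in> carrier G"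
  shows "x \<otimes> (a \<otimes> b) = (a' \<otimes> b') \<otimes> x"
  using assms by (metis m_assoc)

lemma (in group) intertwine_inv:
  assumes "x \<otimes> a = a' \<otimes> x" and "x \<in> carrier G" "a \<in> carrier G" "a' \<in> carrier G"
  shows "x \<otimes> inv a = inv a' \<otimes> x"
  using assms by (metis inv_closed inv_solve_left' inv_solve_right' m_assoc m_closed)

lemma (in group) intertwine_conj:
  assumes "x \<otimes> a = a' \<otimes> x" "x \<otimes> b = b' \<otimes> x"
    and "x \<in> carrier G" "a \<in> carrier G" "b \<in> carrier G" "a' \<in> carrier G" "b' \<in> carrier G"
  shows "x \<otimes> (a \<otimes> b \<otimes> inv a) = (a' \<otimes> b' \<otimes> inv a') \<otimes> x"
  using assms by (intro intertwine_mult intertwine_inv) simp_all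

context artin_generators
begin

text \<open>The half twist \<open>a\<^bsub>ij\<^esub>\<close> of the strands \<open>i\<close> and \<open>j = i + d + 1\<close>, all strands between them passing
  on the same side; the second argument is the number of these strands, which makes the recursion
  structural.\<close>

primrec half_twist :: "nat \<Rightarrow> nat \<Rightarrow> 'a" where
  "half_twist i 0 = s i"
| "half_twist i (Suc d) = s (i + d + 1) \<otimes> half_twist i d \<otimes> inv (s (i + d + 1))"

lemma half_twist_closed:
  "1 \<le> i \<Longrightarrow> i + d < n \<Longrightarrow> half_twist i d \<in> carrier G"
  by (induction d) (simp_all add: s_closed)

lemma s_commute:
  assumes "i \<in> {1..<n}" "j \<in> {1..<n}" "i + 2 \<le> j \<or> j + 2 \<le> i"
  shows "s i \<otimes> s j = s j \<otimes> s i"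
  using assms far[of i j] far[of j i] by auto

lemma half_twist_outer:
  assumes "1 \<le> i" "i + d < n" "k \<in> {1..<n}" "k + 1 < i \<or> i + d + 1 < k"
  shows "s k \<otimes> half_twist i d = half_twist i d \<otimes> s k"
  using assms
proof (induction d)
  case 0
  then show ?case by (auto intro: s_commute)
next
  case (Suc d)
  have "s k \<otimes> s (i + d + 1) = s (i + d + 1) \<otimes> s k"
    using Suc.prems by (intro s_commute) auto
  moreover have "s k \<otimes> half_twist i d = half_twist i d \<otimes> s k"
    using Suc by auto
  ultimately show ?case
    unfolding half_twist.simps using Suc.prems
    by (intro intertwine_conj) (auto simp: s_closed half_twist_closed)
qed

text \<open>The half twist can as well be shortened at its left end. For three strands this is the braid
  relation in the form \<open>\<sigma>\<^bsub>i+1\<^esub> \<sigma>\<^sub>i \<sigma>\<^bsub>i+1\<^esub>\<inverse> = \<sigma>\<^sub>i\<inverse> \<sigma>\<^bsub>i+1\<^esub> \<sigma>\<^sub>i\<close>, and further strands on the right are attached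
  by generators that commute with \<open>\<sigma>\<^sub>i\<close>.\<close>

lemma half_twist_left:
  assumes "1 \<le> i" "i + d + 1 < n"
  shows "s i \<otimes> half_twist i (Suc d) = half_twist (i + 1) d \<otimes> s i"
  using assms
proof (induction d)
  case 0
  then have c: "s i \<in> carrier G" "s (i + 1) \<in> carrier G" by (auto simp: s_closed)
  have "s i \<otimes> (s (i + 1) \<otimes> s i \<otimes> inv (s (i + 1)))
      = (s i \<otimes> s (i + 1) \<otimes> s i) \<otimes> inv (s (i + 1))" using c by (simp add: m_assoc)
  also have "s i \<otimes> s (i + 1) \<otimes> s i = s (i + 1) \<otimes> s i \<otimes> s (i + 1)"
    using 0 by (intro near) auto
  also have "s (i + 1) \<otimes> s i \<otimes> s (i + 1) \<otimes> inv (s (i + 1)) = s (i + 1) \<otimes> s i"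
    using c by (simp add: m_assoc)
  finally show ?case by simp
next
  case (Suc d)
  have "s i \<otimes> s (i + d + 2) = s (i + d + 2) \<otimes> s i"
    using Suc.prems by (intro s_commute) auto
  then show ?case
    unfolding half_twist.simps(2)[of _ "Suc d"] half_twist.simps(2)[of "i + 1" d]
    using Suc half_twist_closed[of i "Suc d"] half_twist_closed[of "i + 1" d]
    by (simp only: add_Suc_right add_Suc add_2_eq_Suc' Suc_eq_plus1[symmetric])
      (intro intertwine_conj; simp add: s_closed)
qed

text \<open>Crossing two strands that lie between \<open>i\<close> and \<open>j\<close> does not affect the half twist. The essential
  case is \<open>j = k + 2\<close>: with \<open>y = \<sigma>\<^bsub>k+1\<^esub> \<sigma>\<^sub>k\<close> the half twist is \<open>y a\<^bsub>ik\<^esub> y\<inverse>\<close>, where \<open>a\<^bsub>ik\<^esub>\<close> commutes with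
  \<open>\<sigma>\<^bsub>k+1\<^esub>\<close>, and \<open>\<sigma>\<^sub>k = y \<sigma>\<^bsub>k+1\<^esub> y\<inverse>\<close> by the braid relation.\<close>

lemma half_twist_inner:
  assumes "1 \<le> i" "i + d < n" "i < k" "k < i + d"
  shows "s k \<otimes> half_twist i d = half_twist i d \<otimes> s k"
  using assms
proof (induction d)
  case 0
  then show ?case by simp
next
  case (Suc d)
  show ?case
  proof (cases "k = i + d")
    case False
    have "s k \<otimes> s (i + d + 1) = s (i + d + 1) \<otimes> s k"
      using Suc.prems False by (intro s_commute) auto
    moreover have "s k \<otimes> half_twist i d = half_twist i d \<otimes> s k"
      using Suc False by auto
    ultimately show ?thesis
      unfolding half_twist.simps using Suc.prems
      by (intro intertwine_conj) (auto simp: s_closed half_twist_closed)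
  next
    case True
    then obtain e where d: "d = Suc e" using Suc.prems by (cases d) auto
    let ?a = "half_twist i e" and ?y = "s (k + 1) \<otimes> s k"
    have c: "s k \<in> carrier G" "s (k + 1) \<in> carrier G" "?a \<in> carrier G"
      using Suc.prems d True by (auto simp: s_closed half_twist_closed)
    \<comment> \<open>here \<open>half_twist i e\<close> is \<open>a\<^bsub>ik\<^esub>\<close>\<close>
    have comm: "s (k + 1) \<otimes> ?a = ?a \<otimes> s (k + 1)"
      using Suc.prems d True by (intro half_twist_outer) auto
    have br: "s k \<otimes> ?y = ?y \<otimes> s (k + 1)"
      using near[of k] Suc.prems True c by (simp add: m_assoc)
    have "half_twist i (Suc d) = ?y \<otimes> ?a \<otimes> inv ?y"
      using c True by (simp add: d inv_mult_group m_assoc)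
    moreover have "s k \<otimes> (?y \<otimes> ?a \<otimes> inv ?y) = (?y \<otimes> ?a \<otimes> inv ?y) \<otimes> s k"
    proof -
      have "s k \<otimes> (?y \<otimes> ?a \<otimes> inv ?y) = ?y \<otimes> (s (k + 1) \<otimes> ?a) \<otimes> inv ?y"
        using c br by (simp add: m_assoc[symmetric])
      also have "\<dots> = ?y \<otimes> ?a \<otimes> (s (k + 1) \<otimes> inv ?y)"
        unfolding comm using c by (simp add: m_assoc del: inv_mult_group)
      also have "s (k + 1) \<otimes> inv ?y = inv ?y \<otimes> s k"
        using br c by (metis inv_solve_left inv_solve_right m_assoc m_closed inv_closed)
      finally show ?thesis using c by (simp add: m_assoc)
    qed
    ultimately show ?thesis by simp
  qed
qed

section \<open>The subgroup generated by the full twists\<close>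

text \<open>The full twist \<open>A\<^bsub>ij\<^esub>\<close> of the strands \<open>i\<close> and \<open>j = i + d + 1\<close>.\<close>

definition pure_twist :: "nat \<Rightarrow> nat \<Rightarrow> 'a" where
  "pure_twist i d = half_twist i d \<otimes> half_twist i d"

definition pure_twists :: "'a set" where
  "pure_twists = {pure_twist i d | i d. 1 \<le> i \<and> i + d < n}"

lemma pure_twists_closed: "pure_twists \<subseteq> carrier G"
  by (auto simp: pure_twists_def pure_twist_def half_twist_closed)

text \<open>In one of the two directions, which depends on the position of \<open>k\<close>, conjugation by \<open>\<sigma>\<^sub>k\<close> moves the
  ends of a twist according to the transposition \<open>(k, k + 1)\<close> and gives exactly a twist again. In the
  opposite direction the result is in general only a product of twists and their inverses.\<close>

lemma pure_twists_conj:
  assumes k: "k \<in> {1..<n}" and x: "x \<in> pure_twists"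
  shows "\<exists>y\<in>pure_twists. s k \<otimes> x = y \<otimes> s k \<or> s k \<otimes> y = x \<otimes> s k"
proof -
  have square: "s k \<otimes> pure_twist i d = pure_twist i' d' \<otimes> s k"
    if "s k \<otimes> half_twist i d = half_twist i' d' \<otimes> s k"
      and "1 \<le> i" "i + d < n" "1 \<le> i'" "i' + d' < n" for i d i' d'
    unfolding pure_twist_def using that k
    by (intro intertwine_mult) (auto simp: s_closed half_twist_closed)
  have mem: "pure_twist i d \<in> pure_twists" if "1 \<le> i" "i + d < n" for i d
    using that by (auto simp: pure_twists_def)
  have up: "s k \<otimes> half_twist i d = half_twist i (Suc d) \<otimes> s k" if "1 \<le> i" "k = i + d + 1" for i d
    using that k by (simp add: m_assoc s_closed half_twist_closed)
  obtain i d where x: "x = pure_twist i d" and i: "1 \<le> i" "i + d < n"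
    using x by (auto simp: pure_twists_def)
  consider "k + 1 < i \<or> i + d + 1 < k \<or> (i < k \<and> k < i + d)" | "k + 1 = i" | "k = i" "d = 0"
    | "k = i" "d > 0" | "k = i + d" "d > 0" | "k = i + d + 1"
    by linarith
  then show ?thesis
  proof cases
    case 1
    then have "s k \<otimes> half_twist i d = half_twist i d \<otimes> s k"
      using half_twist_outer half_twist_inner i k by blast
    from square[OF this i i] mem[OF i] show ?thesis using x by blast
  next
    case 2
    then show ?thesis
      using square[of k "Suc d" i d] half_twist_left[of k d] mem[of k "Suc d"] i k x by auto
  next
    case 3
    then show ?thesis using square[of i 0 i 0] mem i x by auto
  next
    case 4
    then obtain e where "d = Suc e" by (cases d) auto
    then show ?thesis
      using square[of i d "i + 1" e] half_twist_left[of i e] mem[of "i + 1" e] i 4 x by auto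
  next
    case 5
    then obtain e where "d = Suc e" by (cases d) auto
    then show ?thesis
      using square[of i e i d] up[of i e] mem[of i e] i 5 x by auto
  next
    case 6
    then show ?thesis
      using square[of i d i "Suc d"] up[of i d] mem[of i "Suc d"] i k x by auto
  qed
qed

abbreviation twist_subgroup :: "'a set" where
  "twist_subgroup \<equiv> generate G pure_twists"

lemma twist_subgroup: "subgroup twist_subgroup G"
  by (rule generate_is_subgroup[OF pure_twists_closed])

lemma s_square: "k \<in> {1..<n} \<Longrightarrow> s k \<otimes> s k \<in> twist_subgroup"
  by (rule generate.incl) (force simp: pure_twists_def pure_twist_def intro: exI[of _ 0])

text \<open>Conjugation by \<open>\<sigma>\<^sub>k\<close> and by \<open>\<sigma>\<^sub>k\<inverse>\<close> differ by conjugation by \<open>\<sigma>\<^sub>k\<^sup>2\<close>, an element of the subgroup, so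
  control of one direction is enough.\<close>

lemma pure_twist_conj_mem:
  assumes k: "k \<in> {1..<n}" and x: "x \<in> pure_twists"
  shows "s k \<otimes> x \<otimes> inv (s k) \<in> twist_subgroup" "inv (s k) \<otimes> x \<otimes> s k \<in> twist_subgroup"
proof -
  let ?q = "s k \<otimes> s k"
  have c: "s k \<in> carrier G" "x \<in> carrier G" using k x pure_twists_closed by (auto simp: s_closed)
  note H = subgroup.m_closed[OF twist_subgroup] subgroup.m_inv_closed[OF twist_subgroup]
    s_square[OF k]
  obtain y where y: "y \<in> pure_twists" and
    eq: "s k \<otimes> x = y \<otimes> s k \<or> s k \<otimes> y = x \<otimes> s k"
    using pure_twists_conj[OF k x] by blast
  have yc: "y \<in> carrier G" and yH: "y \<in> twist_subgroup"
    using y pure_twists_closed by (auto intro: generate.incl)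
  from eq have "s k \<otimes> x \<otimes> inv (s k) \<in> twist_subgroup \<and> inv (s k) \<otimes> x \<otimes> s k \<in> twist_subgroup"
  proof
    assume e: "s k \<otimes> x = y \<otimes> s k"
    then have 1: "s k \<otimes> x \<otimes> inv (s k) = y" using c yc by (simp add: m_assoc)
    have "inv ?q \<otimes> y \<otimes> ?q = inv (s k) \<otimes> x \<otimes> s k"
      unfolding 1[symmetric] using c by (simp add: m_assoc inv_mult_group cancel_inv_left)
    with 1 show ?thesis using H yH by metis
  next
    assume e: "s k \<otimes> y = x \<otimes> s k"
    then have 1: "inv (s k) \<otimes> x \<otimes> s k = y" using c yc by (simp add: m_assoc e[symmetric] cancel_inv_left)
    have "?q \<otimes> y \<otimes> inv ?q = s k \<otimes> x \<otimes> inv (s k)"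
      unfolding 1[symmetric] using c by (simp add: m_assoc inv_mult_group cancel_inv_left)
    with 1 show ?thesis using H yH by metis
  qed
  then show "s k \<otimes> x \<otimes> inv (s k) \<in> twist_subgroup" "inv (s k) \<otimes> x \<otimes> s k \<in> twist_subgroup"
    by auto
qed

end

lemma (in group) generate_conj_closed:
  assumes X: "X \<subseteq> carrier G" and g: "g \<in> carrier G"
    and "\<And>x. x \<in> X \<Longrightarrow> g \<otimes> x \<otimes> inv g \<in> generate G X" and h: "h \<in> generate G X"
  shows "g \<otimes> h \<otimes> inv g \<in> generate G X"
  using h
proof (induction rule: generate.induct)
  case one
  then show ?case using g by (simp add: generate.one)
next
  case (incl h)
  then show ?case by (rule assms(3))
next
  case (inv h)
  have "inv (g \<otimes> h \<otimes> inv g) \<in> generate G X"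
    using assms(3)[OF inv] by (rule generate_m_inv_closed[OF X])
  then show ?case using inv X g by (simp add: inv_mult_group m_assoc subsetD)
next
  case (eng h1 h2)
  then have c: "h1 \<in> carrier G" "h2 \<in> carrier G" using generate_in_carrier[OF X] by auto
  have "g \<otimes> (h1 \<otimes> h2) \<otimes> inv g = (g \<otimes> h1 \<otimes> inv g) \<otimes> (g \<otimes> h2 \<otimes> inv g)"
    using c g by (simp add: inv_solve_left m_assoc)
  then show ?case using eng by (metis generate.eng)
qed

text \<open>Invariance of the generated subgroup need only be tested on generators of both groups. Inverses
  of the conjugating generators have to be included: a subgroup can be mapped properly into itself by
  a conjugation.\<close>

lemma (in group) normal_generate_by_generators:
  assumes X: "X \<subseteq> carrier G" and S: "S \<subseteq> carrier G" "generate G S = carrier G"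
    and conj: "\<And>g x. g \<in> S \<Longrightarrow> x \<in> X \<Longrightarrow> g \<otimes> x \<otimes> inv g \<in> generate G X"
    and conj_inv: "\<And>g x. g \<in> S \<Longrightarrow> x \<in> X \<Longrightarrow> inv g \<otimes> x \<otimes> g \<in> generate G X"
  shows "generate G X \<lhd> G"
proof (rule normal_invI[OF generate_is_subgroup[OF X]])
  fix g h assume "g \<in> carrier G" and h: "h \<in> generate G X"
  then have "g \<in> generate G S" using S(2) by simp
  then show "g \<otimes> h \<otimes> inv g \<in> generate G X" using h
  proof (induction arbitrary: h rule: generate.induct)
    case one
    then show ?case using generate_in_carrier[OF X] by simp
  next
    case (incl g)
    then show ?case using generate_conj_closed[OF X subsetD[OF S(1)] conj] by blast
  next
    case (inv g)
    then have g: "g \<in> carrier G" using S(1) by blast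
    have "inv g \<otimes> x \<otimes> inv (inv g) \<in> generate G X" if "x \<in> X" for x
      using conj_inv[OF inv(1) that] g by simp
    from generate_conj_closed[OF X inv_closed[OF g] this inv(2)] show ?case .
  next
    case (eng g1 g2)
    have c: "g1 \<in> carrier G" "g2 \<in> carrier G" "h \<in> carrier G"
      using eng generate_in_carrier[OF S(1)] generate_in_carrier[OF X] by auto
    have "g1 \<otimes> (g2 \<otimes> h \<otimes> inv g2) \<otimes> inv g1 \<in> generate G X" by (intro eng)
    then show ?case using c by (simp add: m_assoc inv_mult_group cancel_inv_left)
  qed
qed

text \<open>Meant for a union \<open>U\<close> of cosets, which is not visibly closed under products.\<close>

lemma (in group) generate_subset_right_mult:
  assumes S: "S \<subseteq> carrier G" and U: "U \<subseteq> carrier G" "\<one> \<in> U"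
    and closed: "\<And>u x. u \<in> U \<Longrightarrow> x \<in> S \<Longrightarrow> u \<otimes> x \<in> U"
      "\<And>u x. u \<in> U \<Longrightarrow> x \<in> S \<Longrightarrow> u \<otimes> inv x \<in> U"
  shows "generate G S \<subseteq> U"
proof
  have right: "u \<otimes> g \<in> U" if "g \<in> generate G S" "u \<in> U" for u g
    using that
  proof (induction arbitrary: u rule: generate.induct)
    case one
    then show ?case using U(1) by (simp add: subsetD)
  next
    case (eng g1 g2)
    have "g1 \<in> carrier G" "g2 \<in> carrier G" "u \<in> carrier G"
      using eng generate_in_carrier[OF S] U(1) by auto
    then show ?case using eng by (simp add: m_assoc[symmetric])
  qed (use closed in auto)
  fix g assume g: "g \<in> generate G S"
  then have "\<one> \<otimes> g \<in> U" using right U(2) by blast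
  then show "g \<in> U" using generate_in_carrier[OF S g] by simp
qed

context artin_generators
begin

lemma twist_subgroup_normal: "twist_subgroup \<lhd> G"
proof (rule normal_generate_by_generators[OF pure_twists_closed _ generated])
  show "s ` {1..<n} \<subseteq> carrier G" using s_closed by blast
  fix g x assume "g \<in> s ` {1..<n}" and x: "x \<in> pure_twists"
  then obtain k where k: "g = s k" "k \<in> {1..<n}" by blast
  show "g \<otimes> x \<otimes> inv g \<in> twist_subgroup" "inv g \<otimes> x \<otimes> g \<in> twist_subgroup"
    unfolding k(1) by (rule pure_twist_conj_mem[OF k(2) x])+
qed

section \<open>Cosets of the twist subgroup and the kernel\<close>

text \<open>Modulo the twists, \<open>level m\<close> is the Coxeter group on the first \<open>m\<close> strands.\<close>

definition level :: "nat \<Rightarrow> 'a set" where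
  "level m = generate G (twist_subgroup \<union> s ` {1..<m})"

text \<open>\<open>descent m d\<close> is \<open>\<sigma>\<^sub>m \<sigma>\<^bsub>m-1\<^esub> \<cdots> \<sigma>\<^bsub>m-d+1\<^esub>\<close>. For \<open>d = 0, \<dots>, m\<close> these are the minimal coset
  representatives of \<open>S\<^sub>m\<close> in \<open>S\<^bsub>m+1\<^esub>\<close>; they are told apart by the strand \<open>m - d + 1\<close> that ends at
  \<open>m + 1\<close> (\<open>perm_descent\<close>).\<close>

primrec descent :: "nat \<Rightarrow> nat \<Rightarrow> 'a" where
  "descent m 0 = \<one>"
| "descent m (Suc d) = descent m d \<otimes> s (m - d)"

lemma descent_closed: "d \<le> m \<Longrightarrow> m < n \<Longrightarrow> descent m d \<in> carrier G"
  by (induction d) (auto intro!: m_closed s_closed)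

lemma level_gens_closed: "m \<le> n \<Longrightarrow> twist_subgroup \<union> s ` {1..<m} \<subseteq> carrier G"
  using subgroup.subset[OF twist_subgroup] s_closed by auto

lemma level_subgroup: "m \<le> n \<Longrightarrow> subgroup (level m) G"
  unfolding level_def by (intro generate_is_subgroup level_gens_closed)

lemma descent_lower:
  assumes "1 \<le> k" "k + d < m" "m < n"
  shows "descent m d \<otimes> s k = s k \<otimes> descent m d"
  using assms
proof (induction d)
  case 0
  then show ?case by (simp add: s_closed)
next
  case (Suc d)
  have c: "descent m d \<in> carrier G" "s k \<in> carrier G" "s (m - d) \<in> carrier G"
    using Suc.prems by (auto intro!: s_closed descent_closed)
  have "s k \<otimes> s (m - d) = s (m - d) \<otimes> s k" using Suc.prems by (intro s_commute) auto
  moreover have "s k \<otimes> descent m d = descent m d \<otimes> s k" using Suc by simp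
  ultimately have "s k \<otimes> (descent m d \<otimes> s (m - d)) = (descent m d \<otimes> s (m - d)) \<otimes> s k"
    using c by (intro intertwine_mult) auto
  then show ?case by simp
qed

text \<open>Moving \<open>\<sigma>\<^sub>k\<close> to the left, the braid relation is used once, where \<open>\<sigma>\<^sub>k\<close> meets \<open>\<sigma>\<^sub>k \<sigma>\<^bsub>k-1\<^esub>\<close>, and lowers
  the index by one.\<close>

lemma descent_upper:
  assumes "k \<le> m" "m + 1 < k + d" "d \<le> m" "m < n"
  shows "descent m d \<otimes> s k = s (k - 1) \<otimes> descent m d"
  using assms
proof (induction d)
  case 0
  then show ?case by simp
next
  case (Suc d)
  show ?case
  proof (cases "k + d = m + 1")
    case False
    have c: "descent m d \<in> carrier G" "s k \<in> carrier G" "s (m - d) \<in> carrier G"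
      "s (k - 1) \<in> carrier G"
      using Suc.prems False by (auto intro!: s_closed descent_closed)
    have "s (m - d) \<otimes> s k = s k \<otimes> s (m - d)"
      using Suc.prems False by (intro s_commute) auto
    then have "descent m (Suc d) \<otimes> s k = descent m d \<otimes> (s k \<otimes> s (m - d))"
      using c by (simp add: m_assoc)
    also have "\<dots> = s (k - 1) \<otimes> descent m (Suc d)"
      using Suc.IH Suc.prems False c by (simp add: m_assoc[symmetric])
    finally show ?thesis .
  next
    case True
    then obtain e where d: "d = Suc e" using Suc.prems by (cases d) auto
    let ?j = "k - 1"
    have k: "m - e = ?j + 1" "m - d = ?j" "k = ?j + 1" "1 \<le> ?j" using True d Suc.prems by auto
    have c: "descent m e \<in> carrier G" "s ?j \<in> carrier G" "s (?j + 1) \<in> carrier G"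
      using Suc.prems k d by (auto intro!: s_closed descent_closed)
    have "descent m (Suc d) \<otimes> s k = descent m e \<otimes> (s (?j + 1) \<otimes> s ?j \<otimes> s (?j + 1))"
      unfolding d descent.simps using k c d by (simp add: m_assoc)
    also have "\<dots> = descent m e \<otimes> (s ?j \<otimes> s (?j + 1) \<otimes> s ?j)"
      using near[of ?j] k Suc.prems by simp
    also have "\<dots> = (descent m e \<otimes> s ?j) \<otimes> s (?j + 1) \<otimes> s ?j" using c by (simp add: m_assoc)
    also have "descent m e \<otimes> s ?j = s ?j \<otimes> descent m e"
      using k Suc.prems d by (intro descent_lower) auto
    also have "s ?j \<otimes> descent m e \<otimes> s (?j + 1) \<otimes> s ?j = s ?j \<otimes> descent m (Suc d)"
      unfolding d descent.simps using k c d by (simp add: m_assoc)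
    finally show ?thesis by simp
  qed
qed

text \<open>The union of the cosets of \<open>level m\<close> on the right is stable under right multiplication by the
  generators: \<open>\<sigma>\<^sub>k\<close> either passes through the descent into \<open>level m\<close>, or prolongs it, or cancels its
  last factor up to the twist \<open>\<sigma>\<^sub>k\<^sup>2\<close>. Normality lets twists pass through the descent, and reduces
  \<open>\<sigma>\<^sub>k\<inverse> = \<sigma>\<^sub>k \<sigma>\<^sub>k\<^sup>-\<^sup>2\<close> to \<open>\<sigma>\<^sub>k\<close>.\<close>

lemma level_coset:
  assumes m: "1 \<le> m" "m < n"
  shows "level (m + 1) \<subseteq> {x \<otimes> descent m d | x d. x \<in> level m \<and> d \<le> m}"
proof -
  define U where "U = {x \<otimes> descent m d | x d. x \<in> level m \<and> d \<le> m}"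
  have sub: "subgroup (level m) G" using m by (intro level_subgroup) auto
  note lev = subgroup.mem_carrier[OF sub]
  have H: "h \<in> level m" if "h \<in> twist_subgroup" for h
    unfolding level_def using that by (intro generate.incl) auto
  have sl: "s k \<in> level m" if "k \<in> {1..<m}" for k
    unfolding level_def using that by (intro generate.incl) auto
  have Uc: "U \<subseteq> carrier G" using m by (auto simp: U_def lev descent_closed)
  have U: "x \<otimes> descent m d \<in> U" if "x \<in> level m" "d \<le> m" for x d using that by (auto simp: U_def)
  have U_H: "u \<otimes> h \<in> U" if u: "u \<in> U" and h: "h \<in> twist_subgroup" for u h
  proof -
    obtain x d where x: "u = x \<otimes> descent m d" "x \<in> level m" "d \<le> m"
      using u by (auto simp: U_def)
    have c: "descent m d \<in> carrier G" "h \<in> carrier G" "x \<in> carrier G"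
      using x h m lev subgroup.mem_carrier[OF twist_subgroup] by (auto simp: descent_closed)
    have "descent m d \<otimes> h \<otimes> inv (descent m d) \<in> twist_subgroup"
      using normal_invE(2)[OF twist_subgroup_normal c(1) h] .
    then have "x \<otimes> (descent m d \<otimes> h \<otimes> inv (descent m d)) \<in> level m"
      using H x(2) subgroup.m_closed[OF sub] by blast
    from U[OF this x(3)] show ?thesis using c x(1) by (simp add: m_assoc)
  qed
  have U_s: "u \<otimes> s k \<in> U" if u: "u \<in> U" and k: "k \<in> {1..<m + 1}" for u k
  proof -
    obtain x d where x: "u = x \<otimes> descent m d" "x \<in> level m" "d \<le> m"
      using u by (auto simp: U_def)
    have c: "descent m d \<in> carrier G" "s k \<in> carrier G" "x \<in> carrier G"
      using x k m lev by (auto simp: descent_closed s_closed)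
    consider "k + d < m" | "k + d = m" | "k + d = m + 1" | "m + 1 < k + d" by linarith
    then show ?thesis
    proof cases
      case 1
      then have "u \<otimes> s k = (x \<otimes> s k) \<otimes> descent m d"
        using c x(1) k m descent_lower[of k d m] by (simp add: m_assoc)
      moreover have "x \<otimes> s k \<in> level m"
        using x(2) sl[of k] k 1 by (intro subgroup.m_closed[OF sub]) auto
      ultimately show ?thesis using U x(3) by metis
    next
      case 2
      then have "u \<otimes> s k = x \<otimes> descent m (Suc d)" using c x(1) k
        by (simp add: m_assoc flip: 2)
      then show ?thesis using U[OF x(2), of "Suc d"] 2 k by simp
    next
      case 3
      then obtain e where d: "d = Suc e" using k by (cases d) auto
      with 3 k x have e: "m - e = k" "e \<le> m" by auto
      have ce: "descent m e \<in> carrier G" using e m by (simp add: descent_closed)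
      have "u \<otimes> s k = x \<otimes> descent m e \<otimes> (s k \<otimes> s k)"
        unfolding x(1) d descent.simps e using c ce by (simp add: m_assoc)
      moreover have "s k \<otimes> s k \<in> twist_subgroup" using k m by (intro s_square) auto
      ultimately show ?thesis using U_H U x(2) e by metis
    next
      case 4
      have "s (k - 1) \<in> carrier G" using 4 x(3) k m by (intro s_closed) auto
      then have "u \<otimes> s k = (x \<otimes> s (k - 1)) \<otimes> descent m d"
        using 4 c x(1,3) k m descent_upper[of k m d] by (simp add: m_assoc)
      moreover have "x \<otimes> s (k - 1) \<in> level m"
      proof (rule subgroup.m_closed[OF sub x(2) sl])
        show "k - 1 \<in> {1..<m}" using x(3) k 4 by auto
      qed
      ultimately show ?thesis using U x(3) by metis
    qed
  qed
  show ?thesis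
    unfolding level_def[of "m + 1"] U_def[symmetric]
  proof (rule generate_subset_right_mult)
    show "twist_subgroup \<union> s ` {1..<m + 1} \<subseteq> carrier G" using m by (intro level_gens_closed) auto
    show "U \<subseteq> carrier G" by (rule Uc)
    show "\<one> \<in> U" using U[OF subgroup.one_closed[OF sub], of 0] by simp
    fix u x assume u: "u \<in> U" and x: "x \<in> twist_subgroup \<union> s ` {1..<m + 1}"
    show "u \<otimes> x \<in> U" using x U_H[OF u] U_s[OF u] by blast
    show "u \<otimes> inv x \<in> U"
      using x
    proof
      assume "x \<in> twist_subgroup"
      then show ?thesis using U_H[OF u] subgroup.m_inv_closed[OF twist_subgroup] by blast
    next
      assume "x \<in> s ` {1..<m + 1}"
      then obtain k where k: "x = s k" "k \<in> {1..<m + 1}" by blast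
      then have kn: "k \<in> {1..<n}" using m by auto
      have c: "u \<in> carrier G" "s k \<in> carrier G" using u Uc kn s_closed by auto
      have "(u \<otimes> s k) \<otimes> inv (s k \<otimes> s k) \<in> U"
        using U_H[OF U_s[OF u k(2)]] s_square[OF kn] subgroup.m_inv_closed[OF twist_subgroup]
        by blast
      then show ?thesis using c k(1) by (simp add: m_assoc inv_mult_group cancel_inv_left)
    qed
  qed
qed

lemma perm_inv: "x \<in> carrier G \<Longrightarrow> perm x \<circ> perm (inv x) = id"
  using perm_mult[of x "inv x"] perm_one by simp

lemma perm_half_twist_square:
  "1 \<le> i \<Longrightarrow> i + d < n \<Longrightarrow> perm (half_twist i d) \<circ> perm (half_twist i d) = id"
proof (induction d)
  case 0
  then show ?case by (simp add: perm_s)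
next
  case (Suc d)
  let ?t = "s (i + d + 1)" and ?a = "half_twist i d"
  have c: "?t \<in> carrier G" "?a \<in> carrier G" using Suc.prems by (auto simp: s_closed half_twist_closed)
  have t: "perm (inv ?t) \<circ> perm ?t = id" using perm_inv[of "inv ?t"] c by simp
  have "perm (half_twist i (Suc d)) \<circ> perm (half_twist i (Suc d))
     = perm ?t \<circ> (perm ?a \<circ> (perm (inv ?t) \<circ> perm ?t) \<circ> perm ?a) \<circ> perm (inv ?t)"
    using c by (simp add: perm_mult comp_assoc)
  also have "\<dots> = id" using Suc c by (simp only: t comp_id perm_inv)
  finally show ?case .
qed

lemma perm_pure_twist: "x \<in> pure_twists \<Longrightarrow> perm x = id"
  by (auto simp: pure_twists_def pure_twist_def perm_mult half_twist_closed perm_half_twist_square)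

lemma perm_fixing_subgroup: "subgroup {x \<in> carrier G. \<forall>i\<in>I. perm x i = i} G"
proof (rule subgroup.intro)
  fix x assume "x \<in> {x \<in> carrier G. \<forall>i\<in>I. perm x i = i}"
  then have x: "x \<in> carrier G" "\<forall>i\<in>I. perm x i = i" by auto
  have "perm (inv x) (perm x i) = i" for i
    using perm_inv[of "inv x"] x(1) by (metis comp_apply id_apply inv_closed inv_inv)
  then show "inv x \<in> {x \<in> carrier G. \<forall>i\<in>I. perm x i = i}" using x by auto metis
qed (auto simp: perm_mult perm_one)

lemma perm_twist_subgroup: "x \<in> twist_subgroup \<Longrightarrow> perm x = id"
  using generate_subgroup_incl[OF _ perm_fixing_subgroup[of UNIV], of pure_twists]
    pure_twists_closed perm_pure_twist by fastforce

lemma perm_level: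
  assumes "1 \<le> m" "m \<le> n" "x \<in> level m" "m < i"
  shows "perm x i = i"
proof -
  have "twist_subgroup \<union> s ` {1..<m} \<subseteq> {x \<in> carrier G. \<forall>i\<in>{m<..}. perm x i = i}"
    using level_gens_closed assms(2) perm_twist_subgroup perm_s by (auto simp: transpose_def)
  from generate_subgroup_incl[OF this perm_fixing_subgroup] show ?thesis
    using assms by (auto simp: level_def)
qed

lemma perm_descent: "d \<le> m \<Longrightarrow> m < n \<Longrightarrow> perm (descent m d) (m - d + 1) = m + 1"
proof (induction d)
  case 0
  then show ?case by (simp add: perm_one)
next
  case (Suc d)
  then have "perm (descent m (Suc d)) = perm (descent m d) \<circ> transpose (m - d) (m - d + 1)"
  proof -
    have md: "m - d \<in> {1..<n}" using Suc.prems by auto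
    show ?thesis
      using Suc.prems perm_mult[OF descent_closed[of d m] s_closed[OF md]] perm_s[OF md] by simp
  qed
  then show ?case using Suc by (simp add: Suc_diff_Suc)
qed

text \<open>Write \<open>x = y c\<close> with \<open>y\<close> in the level below and \<open>c\<close> a descent. Here \<open>y\<close> fixes \<open>m + 1\<close> and \<open>x\<close> fixes
  everything, so \<open>c\<close> fixes \<open>m + 1\<close> and is trivial; thus \<open>x\<close> sinks to level 1, the twist subgroup.\<close>

lemma level_kernel:
  assumes "1 \<le> m" "m \<le> n" "x \<in> level m" "perm x = id"
  shows "x \<in> twist_subgroup"
  using assms
proof (induction m rule: nat_induct_at_least)
  case base
  then show ?case using generate_subgroup_incl[OF _ twist_subgroup] by (auto simp: level_def)
next
  case (Suc m)
  then obtain y d where y: "x = y \<otimes> descent m d" "y \<in> level m" "d \<le> m"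
    using level_coset[of m] by auto
  have c: "y \<in> carrier G" "descent m d \<in> carrier G"
    using subgroup.mem_carrier[OF level_subgroup[of m]] y Suc.prems by (auto simp: descent_closed)
  have "perm x (m - d + 1) = perm y (m + 1)"
    using y Suc.prems c perm_descent[of d m] by (simp add: perm_mult)
  also have "\<dots> = m + 1" using perm_level[of m y "m + 1"] y Suc by simp
  finally have "d = 0" using Suc.prems y(3) by simp
  then show ?case using Suc y c by simp
qed

lemma kernel_perm_generated:
  assumes "1 \<le> n"
  shows "{x \<in> carrier G. perm x = id} = generate G pure_twists"
proof -
  have "level n = carrier G"
    using generated mono_generate[of "s ` {1..<n}" "twist_subgroup \<union> s ` {1..<n}"]
      subgroup.subset[OF level_subgroup[of n]] by (auto simp: level_def)
  then show ?thesis
    using level_kernel[of n] assms perm_twist_subgroup subgroup.subset[OF twist_subgroup] by auto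
qed

section \<open>Small generating sets\<close>

text \<open>\<open>ascent m\<close> is \<open>\<sigma>\<^sub>1 \<sigma>\<^sub>2 \<cdots> \<sigma>\<^sub>m\<close>; for \<open>m = n - 1\<close> it rotates all strands by one place.\<close>

primrec ascent :: "nat \<Rightarrow> 'a" where
  "ascent 0 = \<one>"
| "ascent (Suc m) = ascent m \<otimes> s (Suc m)"

lemma ascent_closed: "m < n \<Longrightarrow> ascent m \<in> carrier G"
  by (induction m) (simp_all add: s_closed)

lemma ascent_commute:
  assumes "j + 1 < k" "k < n"
  shows "ascent j \<otimes> s k = s k \<otimes> ascent j"
  using assms
proof (induction j)
  case 0
  then show ?case by (simp add: s_closed)
next
  case (Suc j)
  have c: "ascent j \<in> carrier G" "s (Suc j) \<in> carrier G" "s k \<in> carrier G"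
    using Suc.prems by (auto simp: s_closed ascent_closed)
  have "s k \<otimes> s (Suc j) = s (Suc j) \<otimes> s k" using Suc.prems by (intro s_commute) auto
  then have "s k \<otimes> (ascent j \<otimes> s (Suc j)) = (ascent j \<otimes> s (Suc j)) \<otimes> s k"
    using Suc c by (intro intertwine_mult) auto
  then show ?case by simp
qed

lemma ascent_shift:
  assumes "1 \<le> k" "k < m" "m < n"
  shows "ascent m \<otimes> s k = s (k + 1) \<otimes> ascent m"
  using assms
proof (induction m)
  case 0
  then show ?case by simp
next
  case (Suc m)
  show ?case
  proof (cases "k = m")
    case False
    have c: "ascent m \<in> carrier G" "s k \<in> carrier G" "s (k + 1) \<in> carrier G" "s (Suc m) \<in> carrier G"
      using Suc.prems by (auto simp: s_closed ascent_closed)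
    have "s k \<otimes> s (Suc m) = s (Suc m) \<otimes> s k"
      using Suc.prems False by (intro s_commute) auto
    then have "ascent (Suc m) \<otimes> s k = (ascent m \<otimes> s k) \<otimes> s (Suc m)"
      using c by (simp add: m_assoc)
    also have "\<dots> = s (k + 1) \<otimes> ascent (Suc m)"
      using Suc False c by (simp add: m_assoc)
    finally show ?thesis .
  next
    case True
    then obtain j where m: "m = Suc j" using Suc.prems by (cases m) auto
    have c: "ascent j \<in> carrier G" "s m \<in> carrier G" "s (Suc m) \<in> carrier G"
      using Suc.prems m True by (auto simp: s_closed ascent_closed)
    have t: "ascent j \<otimes> s (Suc m) = s (Suc m) \<otimes> ascent j"
      using Suc.prems m True by (intro ascent_commute) auto
    have "ascent (Suc m) \<otimes> s k = ascent j \<otimes> (s m \<otimes> s (Suc m) \<otimes> s m)"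
      using c True m by (simp add: m_assoc)
    also have "s m \<otimes> s (Suc m) \<otimes> s m = s (Suc m) \<otimes> s m \<otimes> s (Suc m)"
      using near[of m] Suc.prems True by simp
    also have "ascent j \<otimes> \<dots> = (ascent j \<otimes> s (Suc m)) \<otimes> (s m \<otimes> s (Suc m))"
      using c by (simp add: m_assoc)
    also have "\<dots> = s (k + 1) \<otimes> ascent (Suc m)"
      unfolding t using c True m by (simp add: m_assoc)
    finally show ?thesis .
  qed
qed

lemma generate_first_ascent:
  assumes "2 \<le> n"
  shows "generate G {s 1, ascent (n - 1)} = carrier G"
proof -
  let ?A = "{s 1, ascent (n - 1)}"
  have c: "?A \<subseteq> carrier G" using assms by (simp add: s_closed ascent_closed)
  note sub = generate_is_subgroup[OF c]
  have "s k \<in> generate G ?A" if "1 \<le> k" "k < n" for k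
    using that
  proof (induction k rule: nat_induct_at_least)
    case base
    then show ?case by (simp add: generate.incl)
  next
    case (Suc k)
    have ck: "s k \<in> carrier G" "s (k + 1) \<in> carrier G" "ascent (n - 1) \<in> carrier G"
      using Suc by (auto simp: s_closed ascent_closed)
    have "ascent (n - 1) \<otimes> s k = s (k + 1) \<otimes> ascent (n - 1)"
      using Suc by (intro ascent_shift) auto
    then have "s (k + 1) = ascent (n - 1) \<otimes> s k \<otimes> inv (ascent (n - 1))"
      using ck by (simp add: m_assoc)
    moreover have "ascent (n - 1) \<in> generate G ?A" by (simp add: generate.incl)
    ultimately show ?case
      using Suc subgroup.m_closed[OF sub] subgroup.m_inv_closed[OF sub] by simp
  qed
  then have "s ` {1..<n} \<subseteq> generate G ?A" by auto
  from generate_subgroup_incl[OF this sub] show ?thesis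
    using generated generate_incl[OF c] by simp
qed

text \<open>With \<open>y = \<sigma>\<^sub>k \<sigma>\<^bsub>k+1\<^esub>\<close> the braid relation reads \<open>y \<sigma>\<^sub>k = \<sigma>\<^bsub>k+1\<^esub> y\<close>, so consecutive generators are
  conjugate.\<close>

lemma normal_closure_first:
  assumes "2 \<le> n"
  shows "normal_closure G {s 1} = carrier G"
proof
  show "normal_closure G {s 1} \<subseteq> carrier G"
    unfolding normal_closure_def using normal_self s_closed[of 1] assms by auto
  show "carrier G \<subseteq> normal_closure G {s 1}"
    unfolding normal_closure_def
  proof (rule Inter_greatest)
    fix N assume "N \<in> {N. N \<lhd> G \<and> {s 1} \<subseteq> N}"
    then have N: "N \<lhd> G" "s 1 \<in> N" by auto
    have "s k \<in> N" if "1 \<le> k" "k < n" for k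
      using that
    proof (induction k rule: nat_induct_at_least)
      case base
      show ?case by (rule N(2))
    next
      case (Suc k)
      let ?y = "s k \<otimes> s (k + 1)"
      have ck: "s k \<in> carrier G" "s (k + 1) \<in> carrier G" using Suc by (auto simp: s_closed)
      have "?y \<otimes> s k \<otimes> inv ?y = s (k + 1) \<otimes> ?y \<otimes> inv ?y"
        using near[of k] Suc ck by (simp add: m_assoc)
      also have "\<dots> = s (k + 1)" using ck by (simp only: m_assoc m_closed r_inv inv_closed r_one)
      finally show ?case using normal_invE(2)[OF N(1), of ?y "s k"] Suc ck by simp
    qed
    then have "s ` {1..<n} \<subseteq> N" by auto
    from generate_subgroup_incl[OF this normal_imp_subgroup[OF N(1)]] show "carrier G \<subseteq> N"
      using generated by simp
  qed
qed

lemma not_commutative: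
  assumes "3 \<le> n"
  shows "s 1 \<otimes> s 2 \<noteq> s 2 \<otimes> s 1"
proof
  assume "s 1 \<otimes> s 2 = s 2 \<otimes> s 1"
  then have "perm (s 1) \<circ> perm (s 2) = perm (s 2) \<circ> perm (s 1)"
    using assms perm_mult[of "s 1" "s 2"] perm_mult[of "s 2" "s 1"] by (simp add: s_closed)
  then have "(transpose 1 2 \<circ> transpose 2 3) (1::nat) = (transpose 2 3 \<circ> transpose 1 2) (1::nat)"
    using assms perm_s[of 1] perm_s[of 2] by (simp add: numeral_eq_Suc)
  then show False by (simp add: transpose_def)
qed

end

section \<open>The presentation\<close>

lemma pres_class_in_carrier:
  "u \<in> words S \<Longrightarrow> pres_rel S R `` {u} \<in> carrier (presented_group S R)"
  by (simp add: presented_group_def quotientI)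

lemma pres_class_cases:
  assumes "X \<in> carrier (presented_group S R)"
  obtains u where "u \<in> words S" "X = pres_rel S R `` {u}"
  using assms by (auto simp: presented_group_def elim!: quotientE)

lemma pres_class_eq: "(u, v) \<in> pres_rel S R \<Longrightarrow> pres_rel S R `` {u} = pres_rel S R `` {v}"
  by (rule equiv_class_eq[OF equiv_pres_rel])

lemma presented_group_generated:
  "generate (presented_group S R) (pres_gen S R ` S) = carrier (presented_group S R)"
proof
  interpret group "presented_group S R" by (rule presented_group_is_group)
  let ?G = "presented_group S R" and ?c = "\<lambda>u. pres_rel S R `` {u}"
  have "pres_gen S R ` S \<subseteq> carrier ?G"
    by (auto simp: pres_gen_def words_def intro!: pres_class_in_carrier)
  then show "generate ?G (pres_gen S R ` S) \<subseteq> carrier ?G" by (rule generate_incl)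
  have one: "\<one>\<^bsub>?G\<^esub> = ?c []" by (simp add: presented_group_def)
  have letter: "?c [(x, b)] \<in> generate ?G (pres_gen S R ` S)" if x: "x \<in> S" for x b
  proof (cases b)
    case True
    then show ?thesis using x by (auto simp: pres_gen_def intro!: generate.incl)
  next
    case False
    have w: "[(x, True)] \<in> words S" "[(x, False)] \<in> words S" using x by (auto simp: words_def)
    have "?c [(x, False)] \<otimes>\<^bsub>?G\<^esub> ?c [(x, True)] = \<one>\<^bsub>?G\<^esub>"
      unfolding presented_group_mult[OF w(2,1)] one
      using pres_class_eq[OF pres_rel.cancel[OF x, of False R]] by simp
    then have "?c [(x, False)] = inv\<^bsub>?G\<^esub> (pres_gen S R x)"
      using w by (simp add: inv_equality pres_class_in_carrier pres_gen_def)
    then show ?thesis using False x by (auto intro!: generate.inv)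
  qed
  have "?c u \<in> generate ?G (pres_gen S R ` S)" if "u \<in> words S" for u
    using that
  proof (induction u)
    case Nil
    then show ?case using generate.one[of ?G] by (simp add: one)
  next
    case (Cons a u)
    obtain x b where a: "a = (x, b)" by (cases a)
    with Cons.prems have w: "x \<in> S" "[a] \<in> words S" "u \<in> words S" by (auto simp: words_def)
    have "?c (a # u) = ?c [a] \<otimes>\<^bsub>?G\<^esub> ?c u" using presented_group_mult[OF w(2,3)] by simp
    then show ?case using generate.eng[OF letter[OF w(1), of b] Cons.IH[OF w(3)]] a by simp
  qed
  then show "carrier ?G \<subseteq> generate ?G (pres_gen S R ` S)" using pres_class_cases by blast
qed

lemma braid_gen_commute:
  assumes "i \<in> {1..<n}" "j \<in> {1..<n}" "i + 2 \<le> j"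
  shows "braid_gen n i \<otimes>\<^bsub>braid_group n\<^esub> braid_gen n j
      = braid_gen n j \<otimes>\<^bsub>braid_group n\<^esub> braid_gen n i"
proof -
  have w: "[(i, True)] \<in> words {1..n - 1}" "[(j, True)] \<in> words {1..n - 1}"
    "[(i, True), (j, True)] \<in> words {1..n - 1}" "[(j, True), (i, True)] \<in> words {1..n - 1}"
    using assms by (auto simp: words_def)
  have "([(i, True), (j, True)], [(j, True), (i, True)]) \<in> braid_relations n"
    using assms unfolding braid_relations_def by force
  from pres_class_eq[OF pres_rel.relation[OF this w(3,4)]] show ?thesis
    unfolding braid_gen_def pres_gen_def braid_group_def presented_group_mult[OF w(1,2)]
      presented_group_mult[OF w(2,1)] by simp
qed

lemma braid_gen_braid_relation:
  assumes "1 \<le> i" "i + 1 < n"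
  shows "braid_gen n i \<otimes>\<^bsub>braid_group n\<^esub> braid_gen n (i + 1) \<otimes>\<^bsub>braid_group n\<^esub> braid_gen n i
      = braid_gen n (i + 1) \<otimes>\<^bsub>braid_group n\<^esub> braid_gen n i \<otimes>\<^bsub>braid_group n\<^esub> braid_gen n (i + 1)"
proof -
  let ?u = "[(i, True), (i + 1, True), (i, True)]"
  let ?v = "[(i + 1, True), (i, True), (i + 1, True)]"
  have w: "?u \<in> words {1..n - 1}" "?v \<in> words {1..n - 1}"
    "[(i, True)] \<in> words {1..n - 1}" "[(i + 1, True)] \<in> words {1..n - 1}"
    "[(i, True), (i + 1, True)] \<in> words {1..n - 1}" "[(i + 1, True), (i, True)] \<in> words {1..n - 1}"
    using assms by (auto simp: words_def)
  have "(?u, ?v) \<in> braid_relations n"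
    using assms unfolding braid_relations_def by auto
  from pres_class_eq[OF pres_rel.relation[OF this w(1,2)]] show ?thesis
    unfolding braid_gen_def pres_gen_def braid_group_def presented_group_mult[OF w(3,4)]
      presented_group_mult[OF w(4,3)]
    using presented_group_mult[OF w(5,3)] presented_group_mult[OF w(6,4)] by simp
qed

interpretation braid: artin_generators "braid_group n" n "braid_gen n" braid_perm for n
proof -
  interpret group "braid_group n" by (rule braid_group_is_group)
  have set: "{1..<n} = {1..n - 1}" by auto
  have hom: "group_hom (braid_group n) (sym_group n) braid_perm"
    by (intro group_hom.intro group_hom_axioms.intro braid_group_is_group sym_group_is_group
        braid_perm_hom)
  show "artin_generators (braid_group n) n (braid_gen n) braid_perm"
  proof unfold_locales
    show "generate (braid_group n) (braid_gen n ` {1..<n}) = carrier (braid_group n)"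
      using presented_group_generated[of "{1..n - 1}" "braid_relations n"]
      unfolding set braid_group_def braid_gen_def[abs_def] .
    show "braid_perm \<one>\<^bsub>braid_group n\<^esub> = id"
      using group_hom.hom_one[OF hom] by (simp add: sym_group_one)
    show "braid_perm (x \<otimes>\<^bsub>braid_group n\<^esub> y) = braid_perm x \<circ> braid_perm y"
      if "x \<in> carrier (braid_group n)" "y \<in> carrier (braid_group n)" for x y
      using hom_mult[OF braid_perm_hom that] by (simp add: sym_group_mult)
    show "braid_gen n i \<in> carrier (braid_group n)" if "i \<in> {1..<n}" for i
      using that unfolding set by (rule braid_gen_in_carrier)
    show "braid_perm (braid_gen n i) = transpose i (i + 1)" if "i \<in> {1..<n}" for i
      using that unfolding set by (rule braid_perm_gen)
  qed (fact braid_gen_commute braid_gen_braid_relation)+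
qed

section \<open>Linking numbers\<close>

text \<open>The number of crossings, counted with sign, at which the strand \<open>a\<close> runs over the strand \<open>b\<close>.
  Strands are named by their positions at the right end of the word, because permutations compose
  right to left. The letter \<open>\<sigma>\<^sub>i\<close> takes the strand at \<open>i\<close> over the one at \<open>i + 1\<close>, and \<open>\<sigma>\<^sub>i\<inverse>\<close> undoes this,
  so there the upper strand is the one that comes from \<open>i + 1\<close>. In a pure braid two strands run
  over each other equally often, so this is their linking number, obtained without a division by 2.\<close>

fun over_crossings :: "nat word \<Rightarrow> nat \<Rightarrow> nat \<Rightarrow> int" where
  "over_crossings [] a b = 0"
| "over_crossings ((i, e) # w) a b = over_crossings w a b +
    (if e then of_bool (word_perm w a = i \<and> word_perm w b = i + 1)
     else - of_bool (word_perm w a = i + 1 \<and> word_perm w b = i))"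

lemma over_crossings_append:
  "over_crossings (u @ v) a b =
    over_crossings v a b + over_crossings u (word_perm v a) (word_perm v b)"
  by (induction u rule: word_perm.induct) (auto simp: word_perm_append)

text \<open>A cancelling pair of letters has the same upper strand with opposite signs, and the braid
  relation permutes the three crossings of three strands without exchanging over and under.\<close>

lemma over_crossings_eq:
  "(u, v) \<in> pres_rel {1..n - 1} (braid_relations n) \<Longrightarrow>
    over_crossings u a b = over_crossings v a b"
proof (induction arbitrary: a b rule: pres_rel.induct)
  case (append u u' v v')
  then show ?case by (simp add: over_crossings_append word_perm_eq[OF append.hyps(2)])
next
  case (cancel x e)
  then show ?case by (cases e) (auto simp: transpose_def)
next
  case (relation u v)
  from relation(1) show ?case
    unfolding braid_relations_def
  proof (elim UnE CollectE exE conjE)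
    fix i j
    assume "(u, v) = ([(i, True), (j, True)], [(j, True), (i, True)])" "\<bar>int i - int j\<bar> \<ge> 2"
    then show ?thesis by (auto simp: transpose_def)
  next
    fix i
    assume "(u, v) = ([(i, True), (i + 1, True), (i, True)], [(i + 1, True), (i, True), (i + 1, True)])"
    then show ?thesis by (auto simp: transpose_def)
  qed
qed auto

text \<open>By \<open>over_crossings_eq\<close> the choice of the representative is immaterial.\<close>

definition over_linking :: "nat word set \<Rightarrow> nat \<Rightarrow> nat \<Rightarrow> int" where
  "over_linking X = over_crossings (SOME w. w \<in> X)"

lemma over_linking_class:
  assumes "u \<in> words {1..n - 1}"
  shows "over_linking (pres_rel {1..n - 1} (braid_relations n) `` {u}) = over_crossings u"
proof -
  let ?C = "pres_rel {1..n - 1} (braid_relations n) `` {u}"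
  have "u \<in> ?C" using pres_rel.refl[OF assms] by blast
  then have "(SOME w. w \<in> ?C) \<in> ?C" by (rule someI)
  then show ?thesis unfolding over_linking_def using over_crossings_eq by (intro ext) force
qed

lemma over_linking_mult:
  assumes "X \<in> carrier (braid_group n)" "Y \<in> carrier (braid_group n)"
  shows "over_linking (X \<otimes>\<^bsub>braid_group n\<^esub> Y) a b
    = over_linking Y a b + over_linking X (braid_perm Y a) (braid_perm Y b)"
proof -
  let ?c = "\<lambda>u. pres_rel {1..n - 1} (braid_relations n) `` {u}"
  obtain u v where u: "u \<in> words {1..n - 1}" "X = ?c u" and v: "v \<in> words {1..n - 1}" "Y = ?c v"
    using assms unfolding braid_group_def by (elim pres_class_cases)
  have uv: "u @ v \<in> words {1..n - 1}" using u(1) v(1) by (auto simp: words_def)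
  show ?thesis
    unfolding u(2) v(2) braid_group_def presented_group_mult[OF u(1) v(1)]
      over_linking_class[OF uv] over_linking_class[OF u(1)] over_linking_class[OF v(1)]
      braid_perm_class[OF v(1)]
    by (rule over_crossings_append)
qed

lemma over_linking_one: "over_linking \<one>\<^bsub>braid_group n\<^esub> a b = 0"
  using over_linking_class[of "[]" n]
  by (simp add: words_def braid_group_def presented_group_def)

lemma over_linking_gen:
  "i \<in> {1..n - 1} \<Longrightarrow> over_linking (braid_gen n i) a b = of_bool (a = i \<and> b = i + 1)"
  using over_linking_class[of "[(i, True)]" n]
  by (simp add: words_def braid_gen_def pres_gen_def)

lemma pure_braids_eq: "pure_braids n = {x \<in> carrier (braid_group n). braid_perm x = id}"
  by (auto simp: pure_braids_def kernel_def sym_group_one)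

text \<open>The crossings of \<open>t\<close> cancel against those of its inverse, since the pure braid between them
  restores the positions; only the names of the strands change.\<close>

lemma over_linking_conj:
  assumes "t \<in> carrier (braid_group n)" "x \<in> pure_braids n"
  shows "over_linking (t \<otimes>\<^bsub>braid_group n\<^esub> x \<otimes>\<^bsub>braid_group n\<^esub> inv\<^bsub>braid_group n\<^esub> t) a b
    = over_linking x (braid_perm (inv\<^bsub>braid_group n\<^esub> t) a) (braid_perm (inv\<^bsub>braid_group n\<^esub> t) b)"
proof -
  have x: "x \<in> carrier (braid_group n)" "braid_perm x = id"
    using assms(2) by (auto simp: pure_braids_eq)
  have "over_linking (inv\<^bsub>braid_group n\<^esub> t) a b
      + over_linking t (braid_perm (inv\<^bsub>braid_group n\<^esub> t) a) (braid_perm (inv\<^bsub>braid_group n\<^esub> t) b) = 0"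
    using over_linking_mult[of t n "inv\<^bsub>braid_group n\<^esub> t" a b] assms(1) over_linking_one by simp
  then show ?thesis using assms(1) x by (simp add: over_linking_mult)
qed

lemma over_linking_pure_twist:
  assumes "1 \<le> i" "i + d < n"
  shows "over_linking (braid.pure_twist n i d) a b
    = of_bool (a = i \<and> b = i + d + 1 \<or> a = i + d + 1 \<and> b = i)"
  using assms
proof (induction d arbitrary: a b)
  case 0
  then show ?case
    by (auto simp: braid.pure_twist_def over_linking_mult braid_gen_in_carrier over_linking_gen
        braid_perm_gen transpose_def)
next
  case (Suc d)
  let ?t = "braid_gen n (i + d + 1)" and ?h = "braid.half_twist n i d"
  have c: "?t \<in> carrier (braid_group n)" "?h \<in> carrier (braid_group n)"
    using Suc.prems braid.half_twist_closed[of i d n] by (auto intro: braid_gen_in_carrier)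
  have pt: "braid_perm ?t = transpose (i + d + 1) (i + d + 2)"
    using Suc.prems braid_perm_gen[of "i + d + 1" n] by simp
  have "braid_perm ?t (braid_perm (inv\<^bsub>braid_group n\<^esub> ?t) a) = a" for a
    using braid.perm_inv[OF c(1)] by (metis comp_apply id_apply)
  then have p: "braid_perm (inv\<^bsub>braid_group n\<^esub> ?t) a = transpose (i + d + 1) (i + d + 2) a" for a
    unfolding pt by (metis transpose_involutory)
  have "braid.pure_twist n i d \<in> braid.pure_twists n"
    using Suc.prems unfolding braid.pure_twists_def by (intro CollectI exI[of _ i] exI[of _ d]) auto
  then have pure: "braid.pure_twist n i d \<in> pure_braids n"
    using braid.perm_pure_twist braid.pure_twists_closed by (auto simp: pure_braids_eq)
  have tr: "transpose (i + d + 1) (i + d + 2) a = c \<longleftrightarrow> a = transpose (i + d + 1) (i + d + 2) c" for a c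
    by (metis transpose_involutory)
  have ends: "transpose (i + d + 1) (i + d + 2) i = i"
    "transpose (i + d + 1) (i + d + 2) (i + d + 1) = i + Suc d + 1"
    by (simp_all add: transpose_def)
  have "braid.pure_twist n i (Suc d)
    = ?t \<otimes>\<^bsub>braid_group n\<^esub> braid.pure_twist n i d \<otimes>\<^bsub>braid_group n\<^esub> inv\<^bsub>braid_group n\<^esub> ?t"
    using c by (simp add: braid.pure_twist_def braid.m_assoc braid.cancel_inv_left)
  then have "over_linking (braid.pure_twist n i (Suc d)) a b
    = over_linking (braid.pure_twist n i d) (transpose (i + d + 1) (i + d + 2) a)
        (transpose (i + d + 1) (i + d + 2) b)"
    by (simp only: over_linking_conj[OF c(1) pure] p)
  also have "\<dots> = of_bool (a = i \<and> b = i + Suc d + 1 \<or> a = i + Suc d + 1 \<and> b = i)"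
    using Suc.prems Suc.IH by (simp only: tr ends add_Suc_right Suc_lessD)
  finally show ?case .
qed

section \<open>Linking modulo two\<close>

definition strand_pairs :: "nat \<Rightarrow> (nat \<times> nat) set" where
  "strand_pairs n = (SIGMA i:{1..n}. {i<..n})"

lemma card_strand_pairs: "card (strand_pairs n) = n * (n - 1) div 2"
proof -
  have "card (strand_pairs n) = (\<Sum>i = 1..n. n - i)" by (simp add: strand_pairs_def)
  also have "\<dots> = (\<Sum>i<n. i)"
    by (rule sum.reindex_bij_witness[of _ "\<lambda>i. n - i" "\<lambda>i. n - i"]) auto
  also have "\<dots> = n * (n - 1) div 2" by (simp add: Sum_Ico_nat flip: atLeast0LessThan)
  finally show ?thesis .
qed

text \<open>The matrix of linking numbers modulo 2, as the set of pairs where it is 1.\<close>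

definition odd_linking :: "nat \<Rightarrow> nat word set \<Rightarrow> (nat \<times> nat) set" where
  "odd_linking n X = {(a, b) \<in> strand_pairs n. odd (over_linking X a b)}"

lemma odd_linking_hom: "group_hom (pure_braid_group n) (parity_group (strand_pairs n)) (odd_linking n)"
proof -
  have "odd_linking n \<in> hom (pure_braid_group n) (parity_group (strand_pairs n))"
  proof (rule homI)
    fix x y assume "x \<in> carrier (pure_braid_group n)" "y \<in> carrier (pure_braid_group n)"
    then show "odd_linking n (x \<otimes>\<^bsub>pure_braid_group n\<^esub> y)
        = odd_linking n x \<otimes>\<^bsub>parity_group (strand_pairs n)\<^esub> odd_linking n y"
      by (auto simp: odd_linking_def pure_braid_group_def pure_braids_eq over_linking_mult)
  qed (auto simp: odd_linking_def)
  then show ?thesis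
    using pure_braid_group_is_group comm_group.axioms(2)[OF comm_group_parity_group]
    by (simp add: group_hom_def group_hom_axioms_def)
qed

text \<open>The twist of two strands has linking number 1 for these and 0 for all other pairs, so the
  twists go to the basis vectors.\<close>

lemma odd_linking_surj: "odd_linking n ` carrier (pure_braid_group n) = Pow (strand_pairs n)"
proof
  interpret group_hom "pure_braid_group n" "parity_group (strand_pairs n)" "odd_linking n"
    by (rule odd_linking_hom)
  show "odd_linking n ` carrier (pure_braid_group n) \<subseteq> Pow (strand_pairs n)"
    by (auto simp: odd_linking_def)
  have twist: "\<exists>x\<in>carrier (pure_braid_group n). odd_linking n x = {p}" if "p \<in> strand_pairs n" for p
  proof -
    obtain i j where ij: "p = (i, j)" by (cases p)
    with that have p: "p = (i, j)" "1 \<le> i" "i < j" "j \<le> n" by (auto simp: strand_pairs_def)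
    then obtain d where j: "j = i + d + 1" using less_iff_Suc_add by auto
    then have d: "i + d < n" using p by simp
    have "braid.pure_twist n i d \<in> braid.pure_twists n"
      using p(2) d unfolding braid.pure_twists_def by blast
    then have "braid.pure_twist n i d \<in> carrier (pure_braid_group n)"
      using braid.perm_pure_twist braid.pure_twists_closed
      by (auto simp: pure_braids_eq pure_braid_group_def)
    moreover have "odd_linking n (braid.pure_twist n i d) = {p}"
      using p d by (auto simp: odd_linking_def over_linking_pure_twist strand_pairs_def j)
    ultimately show ?thesis by blast
  qed
  have "A \<in> odd_linking n ` carrier (pure_braid_group n)"
    if "finite A" "A \<subseteq> strand_pairs n" for A
    using that
  proof (induction A rule: finite_induct)
    case empty
    have "odd_linking n \<one>\<^bsub>pure_braid_group n\<^esub> = {}" using hom_one by simp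
    then show ?case using G.one_closed by (metis image_eqI)
  next
    case (insert p A)
    then obtain x y where "x \<in> carrier (pure_braid_group n)" "odd_linking n x = {p}"
      "y \<in> carrier (pure_braid_group n)" "odd_linking n y = A"
      using twist[of p] by auto
    then have "x \<otimes>\<^bsub>pure_braid_group n\<^esub> y \<in> carrier (pure_braid_group n)"
      "odd_linking n (x \<otimes>\<^bsub>pure_braid_group n\<^esub> y) = insert p A"
      using insert.hyps(2) by auto
    then show ?case by (metis image_eqI)
  qed
  moreover have "finite (strand_pairs n)" by (simp add: strand_pairs_def)
  ultimately show "Pow (strand_pairs n) \<subseteq> odd_linking n ` carrier (pure_braid_group n)"
    using finite_subset by (metis PowD subsetI)
qed

section \<open>Generator numbers of braid groups and pure braid groups\<close>

lemma pure_braid_group_generated: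
  assumes "1 \<le> n"
  shows "braid.pure_twists n \<subseteq> carrier (pure_braid_group n)"
    and "generate (pure_braid_group n) (braid.pure_twists n) = carrier (pure_braid_group n)"
proof -
  show sub: "braid.pure_twists n \<subseteq> carrier (pure_braid_group n)"
    using braid.perm_pure_twist braid.pure_twists_closed
    by (auto simp: pure_braids_eq pure_braid_group_def)
  have "generate (pure_braid_group n) (braid.pure_twists n)
      = generate (braid_group n) (braid.pure_twists n)"
    using sub braid.generate_consistent[OF _ normal_imp_subgroup[OF pure_braids_normal]]
    by (simp add: pure_braid_group_def)
  then show "generate (pure_braid_group n) (braid.pure_twists n) = carrier (pure_braid_group n)"
    using braid.kernel_perm_generated[OF assms] by (simp add: pure_braid_group_def pure_braids_eq)
qed

lemma card_pure_twists:
  "finite (braid.pure_twists n)" "card (braid.pure_twists n) \<le> card (strand_pairs n)"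
proof -
  have "braid.pure_twists n \<subseteq> (\<lambda>(i, j). braid.pure_twist n i (j - i - 1)) ` strand_pairs n"
  proof
    fix x assume "x \<in> braid.pure_twists n"
    then obtain i d where "x = braid.pure_twist n i d" "1 \<le> i" "i + d < n"
      by (auto simp: braid.pure_twists_def)
    then show "x \<in> (\<lambda>(i, j). braid.pure_twist n i (j - i - 1)) ` strand_pairs n"
      by (intro image_eqI[of _ _ "(i, i + d + 1)"]) (auto simp: strand_pairs_def)
  qed
  note sub = this
  have fin: "finite (strand_pairs n)" by (simp add: strand_pairs_def)
  show "finite (braid.pure_twists n)" by (rule finite_subset[OF sub finite_imageI[OF fin]])
  show "card (braid.pure_twists n) \<le> card (strand_pairs n)" by (rule surj_card_le[OF fin sub])
qed

lemma gen_number_braid_group: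
  assumes "2 \<le> n"
  shows "gen_number (braid_group n) = (if n = 2 then 1 else 2)"
    and "normal_gen_number (braid_group n) = 1"
proof -
  let ?s = "braid_gen n" and ?d = "braid.ascent n (n - 1)"
  have c: "?s 1 \<in> carrier (braid_group n)" "?d \<in> carrier (braid_group n)"
    using assms braid.ascent_closed[of "n - 1" n] by (auto intro: braid_gen_in_carrier)
  have "?s 1 \<noteq> \<one>\<^bsub>braid_group n\<^esub>"
  proof
    assume "?s 1 = \<one>\<^bsub>braid_group n\<^esub>"
    then have "transpose 1 2 = (id :: nat \<Rightarrow> nat)"
      using braid.perm_one[of n] braid_perm_gen[of 1 n] assms by (simp add: numeral_2_eq_2)
    then show False by (metis id_apply one_eq_numeral_iff semiring_norm(85) transpose_apply_first)
  qed
  then have lower: "1 \<le> normal_gen_number (braid_group n)"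
    using c(1) by (intro braid.one_le_normal_gen_number) blast
  have "normal_gen_number (braid_group n) \<le> enat (card {?s 1})"
    unfolding normal_gen_number_def
    using c(1) braid.normal_closure_first[OF assms] by (intro INF_lower) auto
  with lower show "normal_gen_number (braid_group n) = 1" by (simp add: one_enat_def)
  have gen: "generate (braid_group n) {?s 1, ?d} = carrier (braid_group n)"
    using assms by (rule braid.generate_first_ascent)
  show "gen_number (braid_group n) = (if n = 2 then 1 else 2)"
  proof (cases "n = 2")
    case True
    then have "?d = ?s 1" using c(1) by simp
    then have "gen_number (braid_group n) \<le> enat 1"
      using c gen by (intro gen_number_le[of "{?s 1}"]) auto
    then show ?thesis
      using True lower braid.normal_gen_number_le_gen_number[of n] by (simp add: one_enat_def)
  next
    case False
    then have "2 \<le> gen_number (braid_group n)"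
      using assms braid.not_commutative[of n]
      by (intro braid.two_le_gen_number[of "?s 1" n "?s 2"] braid_gen_in_carrier) auto
    moreover have "gen_number (braid_group n) \<le> enat 2"
      using c gen by (intro gen_number_le[of "{?s 1, ?d}"]) (auto simp: card_insert_if)
    ultimately show ?thesis using False by (simp add: numeral_eq_enat)
  qed
qed

theorem proposition4:
  fixes n :: nat
  assumes "n \<ge> 2"
  shows "gen_number (braid_group n) = (if n = 2 then 1 else 2)
    \<and> normal_closure (braid_group n) {braid_gen n 1} = carrier (braid_group n)
    \<and> normal_gen_number (braid_group n) = 1
    \<and> normal_gen_number (pure_braid_group n) = enat (n * (n - 1) div 2)
    \<and> gen_number (pure_braid_group n) = enat (n * (n - 1) div 2)
    \<and> gen_number (abelianisation (pure_braid_group n)) = enat (n * (n - 1) div 2)"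
proof -
  have "finite (strand_pairs n)" "1 \<le> n" using assms by (simp_all add: strand_pairs_def)
  then show ?thesis
    using gen_number_braid_group[OF assms] braid.normal_closure_first[OF assms]
      generator_numbers_eqI[OF odd_linking_hom odd_linking_surj _
        pure_braid_group_generated(1) card_pure_twists(1) pure_braid_group_generated(2)
        card_pure_twists(2)]
    by (simp add: card_strand_pairs)
qed

end
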